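(* Let $(\omega_v)_{v\in V}$ be a finite family of meromorphic 1-forms on a Riemann surface $X$ with at most logarithmic singularities (simple poles) at the points $a,b\in X$, let $\Omega=\sum_vA_v\omega_v$, and let $\widetilde J_a^b\in\mathbb{C}\langle\langle A_V\rangle\rangle$ be the scattering operator associated with $\Omega$ and chosen local parameters $t_a,t_b$. Then $$\Delta(\widetilde J_a^b)=\widetilde J_a^b\otimes\widetilde J_a^b.$$
   Context: $\mathbb{C}\langle\langle A_V\rangle\rangle$ is the ring of associative formal power series in free noncommuting variables $A_v$, $v\in V$; these commute with functions and forms. $\Delta:\mathbb{C}\langle\langle A_V\rangle\rangle\to\mathbb{C}\langle\langle A_V\rangle\rangle\widehat\otimes_{\mathbb{C}}\mathbb{C}\langle\langle A_V\rangle\rangle$ is the continuous $\mathbb{C}$-algebra homomorphism with $\Delta(A_v)=A_v\otimes1+1\otimes A_v$. Let $R_a=\mathrm{res}_a\Omega=\sum_v(\mathrm{res}_a\omega_v)A_v$. Let $U_a$ be a disc around $a$ uniformized by $t_a$, in which all $\omega_v$ are regular outside $a$, and $U_a'$ be $U_a$ with a cut from $a$ to the boundary deleted, the cut not meeting $\{\mathrm{Im}\,t_a=0,\mathrm{Re}\,t_a>0\}$; $\log t_a$ is the branch on $U_a'$ real on that interval and $t_a^{R_a}=e^{R_a\log t_a}$. A section $J$ (formal series in the $A_v$ with coefficients functions) is $\nabla_\Omega$-horizontal if $dJ=\Omega J$. The horizontal section normalized at $a$ with respect to $t_a$ is the unique horizontal section $J_a$ in $U_a'$ of the form $J_a=K\,t_a^{R_a}$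 where $K$ extends to a holomorphic section in a neighborhood of $a$ with $K(a)=1$. Similarly for $b$. Scattering operator: embed $U_a',U_b'$ into a connected simply connected domain $W$ to which both $J_a$ and $J_b$ can be analytically continued; then $\widetilde J_a^b:=J_b^{-1}J_a$, which is a constant element of $\mathbb{C}\langle\langle A_V\rangle\rangle$. *)

theory Defs
  imports "HOL-Complex_Analysis.Complex_Analysis"
begin

section \<open>Noncommutative formal power series\<close>

typedef ('v, 'a) ncps = "UNIV :: ('v list \<Rightarrow> 'a) set"
  morphisms nc_coeff Abs_ncps
  by simp

lemma nc_coeff_Abs [simp]: "nc_coeff (Abs_ncps f) w = f w"
  by (simp add: Abs_ncps_inverse)

lemma ncps_eq_iff: "x = y \<longleftrightarrow> (\<forall>w. nc_coeff x w = nc_coeff y w)"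
  by (metis ext nc_coeff_inject)

lemma ncps_eqI: "(\<And>w. nc_coeff x w = nc_coeff y w) \<Longrightarrow> x = y"
  by (simp add: ncps_eq_iff)

instantiation ncps :: (type, ring_1) ring_1
begin

definition "0 = Abs_ncps (\<lambda>_. 0)"
definition "1 = Abs_ncps (\<lambda>w. if w = [] then 1 else 0)"
definition "x + y = Abs_ncps (\<lambda>w. nc_coeff x w + nc_coeff y w)"
definition "- x = Abs_ncps (\<lambda>w. - nc_coeff x w)"
definition "x - y = Abs_ncps (\<lambda>w. nc_coeff x w - nc_coeff y w)"
definition "x * y =
  Abs_ncps (\<lambda>w. \<Sum>i=0..length w. nc_coeff x (take i w) * nc_coeff y (drop i w))"

lemma nc_coeff_0: "nc_coeff 0 w = 0"
  and nc_coeff_1: "nc_coeff 1 w = (if w = [] then 1 else 0)"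
  and nc_coeff_add: "nc_coeff (x + y) w = nc_coeff x w + nc_coeff y w"
  and nc_coeff_uminus: "nc_coeff (- x) w = - nc_coeff x w"
  and nc_coeff_diff: "nc_coeff (x - y) w = nc_coeff x w - nc_coeff y w"
  and nc_coeff_mult: "nc_coeff (x * y) w =
        (\<Sum>i=0..length w. nc_coeff x (take i w) * nc_coeff y (drop i w))"
  by (simp_all add: zero_ncps_def one_ncps_def plus_ncps_def uminus_ncps_def minus_ncps_def
        times_ncps_def)

instance
proof
  fix x y z :: "('a, 'b) ncps"
  show "x * y * z = x * (y * z)"
  proof (rule ncps_eqI)
    fix w :: "'a list"
    let ?n = "length w"
    define F where "F = (\<lambda>i k (l::nat). nc_coeff x (take i w) * nc_coeff y (take k (drop i w))
                            * nc_coeff z (drop (i + k) w))"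
    have "nc_coeff (x * y * z) w = (\<Sum>j=0..?n. \<Sum>i=0..j. F i (j - i) (?n - j))"
      unfolding nc_coeff_mult sum_distrib_right F_def
      by (intro sum.cong refl) (auto simp: min_def drop_take)
    also have "\<dots> = (\<Sum>j=0..?n. \<Sum>i=0..?n - j. F j i (?n - j - i))"
      by (rule fps_mult_assoc_lemma)
    also have "\<dots> = nc_coeff (x * (y * z)) w"
      unfolding nc_coeff_mult sum_distrib_left F_def
      by (intro sum.cong refl) (auto simp: mult.assoc add.commute)
    finally show "nc_coeff (x * y * z) w = nc_coeff (x * (y * z)) w" .
  qed
  show "1 * x = x"
  proof (rule ncps_eqI)
    fix w :: "'a list"
    have "nc_coeff (1 * x) w = (\<Sum>i=0..length w. if i = 0 then nc_coeff x w else 0)"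
      unfolding nc_coeff_mult by (intro sum.cong refl) (auto simp: nc_coeff_1)
    then show "nc_coeff (1 * x) w = nc_coeff x w" by simp
  qed
  show "x * 1 = x"
  proof (rule ncps_eqI)
    fix w :: "'a list"
    have "nc_coeff (x * 1) w = (\<Sum>i=0..length w. if i = length w then nc_coeff x w else 0)"
      unfolding nc_coeff_mult by (intro sum.cong refl) (auto simp: nc_coeff_1)
    then show "nc_coeff (x * 1) w = nc_coeff x w" by simp
  qed
  show "(x + y) * z = x * z + y * z" "x * (y + z) = x * y + x * z"
    by (auto intro!: ncps_eqI simp: nc_coeff_mult nc_coeff_add distrib_left distrib_right
          sum.distrib)
  show "(0::('a,'b) ncps) \<noteq> 1"
    by (auto simp: ncps_eq_iff nc_coeff_0 nc_coeff_1)
qed (auto intro!: ncps_eqI simp: nc_coeff_0 nc_coeff_add nc_coeff_uminus nc_coeff_diff)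

end

lemmas nc_coeff_simps = nc_coeff_0 nc_coeff_1 nc_coeff_add nc_coeff_uminus nc_coeff_diff

definition nc_const :: "'a::ring_1 \<Rightarrow> ('v, 'a) ncps" where
  "nc_const c = Abs_ncps (\<lambda>w. if w = [] then c else 0)"

definition nc_var :: "'v \<Rightarrow> ('v, 'a::ring_1) ncps" where
  "nc_var v = Abs_ncps (\<lambda>w. if w = [v] then 1 else 0)"

definition nc_inverse :: "('v, 'a::ring_1) ncps \<Rightarrow> ('v, 'a) ncps" where
  "nc_inverse x = (THE y. x * y = 1 \<and> y * x = 1)"

definition nc_exp :: "('v, complex) ncps \<Rightarrow> ('v, complex) ncps" where
  "nc_exp x = Abs_ncps (\<lambda>w. \<Sum>n. nc_coeff (x ^ n) w / fact n)"


section \<open>The completed tensor square and the coproduct\<close>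

text \<open>
  The completed tensor product of two copies of the series ring consists of the formal sums
  of \<open>c u w\<close> times \<open>u \<otimes> w\<close> over all pairs of words. It is encoded as the ring of series in the
  variables of the left factor whose coefficients are series in the variables of the right factor:
  the coefficient of \<open>u \<otimes> w\<close> is \<open>nc_coeff (nc_coeff T u) w\<close>. As variables commute
  with coefficients, the product is the one with
  \<open>(u \<otimes> w) (u' \<otimes> w') = u u' \<otimes> w w'\<close>.
\<close>

type_synonym 'v nc_tensor2 = "('v, ('v, complex) ncps) ncps"

definition nc_tensor :: "('v, complex) ncps \<Rightarrow> ('v, complex) ncps \<Rightarrow> 'v nc_tensor2"
    (infixr \<open>\<otimes>\<^sub>A\<close> 72) where
  "x \<otimes>\<^sub>A y = Abs_ncps (\<lambda>u. nc_const (nc_coeff x u) * y)"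

definition agree_below :: "nat \<Rightarrow> ('v, 'a) ncps \<Rightarrow> ('v, 'a) ncps \<Rightarrow> bool" where
  "agree_below n x y \<longleftrightarrow> (\<forall>w. length w < n \<longrightarrow> nc_coeff x w = nc_coeff y w)"

definition agree_below2 :: "nat \<Rightarrow> 'v nc_tensor2 \<Rightarrow> 'v nc_tensor2 \<Rightarrow> bool" where
  "agree_below2 n S T \<longleftrightarrow> (\<forall>u w. length u + length w < n \<longrightarrow>
     nc_coeff (nc_coeff S u) w = nc_coeff (nc_coeff T u) w)"

text \<open>Continuity refers to the topologies given by the degree filtrations.\<close>

definition nc_continuous :: "(('v, complex) ncps \<Rightarrow> 'v nc_tensor2) \<Rightarrow> bool" where
  "nc_continuous D \<longleftrightarrow> (\<forall>x n. \<exists>m. \<forall>y. agree_below m x y \<longrightarrow> agree_below2 n (D x) (D y))"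

definition is_coproduct :: "(('v, complex) ncps \<Rightarrow> 'v nc_tensor2) \<Rightarrow> bool" where
  "is_coproduct D \<longleftrightarrow>
     (\<forall>x y. D (x + y) = D x + D y) \<and> (\<forall>x y. D (x * y) = D x * D y) \<and>
     (\<forall>c. D (nc_const c) = nc_const (nc_const c)) \<and>
     nc_continuous D \<and>
     (\<forall>v. D (nc_var v) = nc_var v \<otimes>\<^sub>A 1 + 1 \<otimes>\<^sub>A nc_var v)"

abbreviation coeff2 :: "'v nc_tensor2 \<Rightarrow> 'v list \<Rightarrow> 'v list \<Rightarrow> complex" where
  "coeff2 T p q \<equiv> nc_coeff (nc_coeff T p) q"

lemma nc_coeff_sum: "nc_coeff (sum f A) w = (\<Sum>i\<in>A. nc_coeff (f i) w)"
  by (induction A rule: infinite_finite_induct) (auto simp: nc_coeff_simps)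

lemma coeff2_mult:
  "coeff2 (S * T) p q = (\<Sum>j=0..length p. \<Sum>k=0..length q.
     coeff2 S (take j p) (take k q) * coeff2 T (drop j p) (drop k q))"
  by (simp add: nc_coeff_mult nc_coeff_sum)

lemma nc_coeff_const_mult: "nc_coeff (nc_const c * x) w = c * nc_coeff x w"
proof -
  have "nc_coeff (nc_const c * x) w = (\<Sum>i=0..length w. if i = 0 then c * nc_coeff x w else 0)"
    unfolding nc_coeff_mult by (intro sum.cong refl) (auto simp: nc_const_def)
  then show ?thesis by simp
qed

lemma coeff2_tensor: "coeff2 (x \<otimes>\<^sub>A y) p q = nc_coeff x p * nc_coeff y q"
  by (simp add: nc_tensor_def nc_coeff_const_mult)

lemma tensor_mult: "(x \<otimes>\<^sub>A y) * (x' \<otimes>\<^sub>A y') = (x * x') \<otimes>\<^sub>A (y * y')"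
proof (intro ncps_eqI)
  fix p q
  show "coeff2 ((x \<otimes>\<^sub>A y) * (x' \<otimes>\<^sub>A y')) p q = coeff2 ((x * x') \<otimes>\<^sub>A (y * y')) p q"
    unfolding coeff2_mult coeff2_tensor
    by (simp add: nc_coeff_mult sum_product mult_ac)
qed

fun nc_word :: "'v list \<Rightarrow> ('v, 'a::ring_1) ncps" where
  "nc_word [] = 1"
| "nc_word (v # w) = nc_var v * nc_word w"

lemma nc_coeff_var_mult:
  "nc_coeff (nc_var v * x) w = (case w of [] \<Rightarrow> 0 | a # u \<Rightarrow> if a = v then nc_coeff x u else 0)"
proof (cases w)
  case Nil
  then show ?thesis by (simp add: nc_coeff_mult nc_var_def)
next
  case (Cons a u)
  have "nc_coeff (nc_var v * x) w =
      (\<Sum>i=0..length w. if i = 1 then (if a = v then nc_coeff x u else 0) else 0)"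
    unfolding nc_coeff_mult
  proof (intro sum.cong refl)
    fix i assume "i \<in> {0..length w}"
    then show "nc_coeff (nc_var v) (take i w) * nc_coeff x (drop i w)
        = (if i = 1 then (if a = v then nc_coeff x u else 0) else 0)"
      using Cons by (cases i) (auto simp: nc_var_def)
  qed
  then show ?thesis using Cons by (auto simp: Suc_le_eq)
qed

lemma nc_coeff_word: "nc_coeff (nc_word u) w = (if w = u then 1 else 0)"
  by (induction u arbitrary: w) (auto simp: nc_coeff_1 nc_coeff_var_mult split: list.split)

fun word_coproduct :: "'v list \<Rightarrow> 'v nc_tensor2" where
  "word_coproduct [] = 1"
| "word_coproduct (v # w) = (nc_var v \<otimes>\<^sub>A 1 + 1 \<otimes>\<^sub>A nc_var v) * word_coproduct w"

lemma word_coproduct_append: "word_coproduct (u @ w) = word_coproduct u * word_coproduct w"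
  by (induction u) (auto simp: mult.assoc)

lemma coeff2_word_coproduct_degree:
  "length p + length q \<noteq> length w \<Longrightarrow> coeff2 (word_coproduct w) p q = 0"
proof (induction w arbitrary: p q)
  case Nil
  then show ?case by (auto simp: nc_coeff_simps)
next
  case (Cons v w)
  show ?case
    unfolding word_coproduct.simps coeff2_mult
  proof (intro sum.neutral ballI)
    fix j k assume "j \<in> {0..length p}" "k \<in> {0..length q}"
    then show "coeff2 (nc_var v \<otimes>\<^sub>A 1 + 1 \<otimes>\<^sub>A nc_var v) (take j p) (take k q) *
       coeff2 (word_coproduct w) (drop j p) (drop k q) = 0"
    proof (cases "j + k = 1")
      case True
      then have "length (drop j p) + length (drop k q) \<noteq> length w"
        using Cons.prems \<open>j \<in> _\<close> \<open>k \<in> _\<close> by auto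
      then show ?thesis using Cons.IH by simp
    next
      case False
      have "coeff2 (nc_var v \<otimes>\<^sub>A 1 + 1 \<otimes>\<^sub>A nc_var v) (take j p) (take k q) = 0"
      proof (rule ccontr)
        assume "\<not> ?thesis"
        then have "(take j p = [v] \<and> take k q = []) \<or> (take j p = [] \<and> take k q = [v])"
          by (auto simp: nc_coeff_add coeff2_tensor nc_coeff_1 nc_var_def split: if_splits)
        then have "length (take j p) + length (take k q) = 1"
          by (metis add.commute add.left_neutral length_Cons list.size(3) One_nat_def)
        then show False using False \<open>j \<in> _\<close> \<open>k \<in> _\<close> by auto
      qed
      then show ?thesis by simp
    qed
  qed
qed

definition coproduct_series :: "('v, complex) ncps \<Rightarrow> 'v nc_tensor2" where
  "coproduct_series x = Abs_ncps (\<lambda>p. Abs_ncps (\<lambda>q.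
     \<Sum>w | length w = length p + length q. nc_coeff x w * coeff2 (word_coproduct w) p q))"

lemma coeff2_coproduct_series:
  "coeff2 (coproduct_series x) p q =
     (\<Sum>w | length w = length p + length q. nc_coeff x w * coeff2 (word_coproduct w) p q)"
  by (simp add: coproduct_series_def)

lemma finite_words: "finite {w :: 'v::finite list. length w = n}"
  using finite_lists_length_eq[of "UNIV :: 'v set" n] by simp

lemma sum_words_split:
  assumes "m \<le> n"
  shows "(\<Sum>w | length w = n. G (take m w) (drop m w)) =
         (\<Sum>u | length u = m. \<Sum>v | length v = n - m. (G u v :: complex))"
  unfolding sum.cartesian_product
  by (rule sum.reindex_bij_witness[of _ "\<lambda>(u, v). u @ v" "\<lambda>w. (take m w, drop m w)"])
     (use assms in auto)

lemma coproduct_series_mult: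
  fixes x y :: "('v::finite, complex) ncps"
  shows "coproduct_series (x * y) = coproduct_series x * coproduct_series y"
proof (intro ncps_eqI)
  fix p q :: "'v list"
  define n where "n = length p + length q"
  define G where "G = (\<lambda>j k u v. (nc_coeff x u * coeff2 (word_coproduct u) (take j p) (take k q)) *
      (nc_coeff y v * coeff2 (word_coproduct v) (drop j p) (drop k q)))"
  have word: "nc_coeff (x * y) w * coeff2 (word_coproduct w) p q =
      (\<Sum>j=0..length p. \<Sum>k=0..length q. G j k (take (j + k) w) (drop (j + k) w))"
    if w: "length w = n" for w
  proof -
    have "nc_coeff (x * y) w * coeff2 (word_coproduct w) p q =
        (\<Sum>i=0..n. nc_coeff x (take i w) * nc_coeff y (drop i w) *
           coeff2 (word_coproduct (take i w) * word_coproduct (drop i w)) p q)"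
      using w by (simp add: nc_coeff_mult[of x y] sum_distrib_right
            flip: word_coproduct_append)
    also have "\<dots> = (\<Sum>i=0..n. \<Sum>j=0..length p. \<Sum>k=0..length q. G j k (take i w) (drop i w))"
      unfolding coeff2_mult G_def by (simp add: sum_distrib_left mult_ac)
    also have "\<dots> = (\<Sum>j=0..length p. \<Sum>i=0..n. \<Sum>k=0..length q. G j k (take i w) (drop i w))"
      by (rule sum.swap)
    also have "\<dots> = (\<Sum>j=0..length p. \<Sum>k=0..length q. \<Sum>i=0..n. G j k (take i w) (drop i w))"
      by (intro sum.cong refl sum.swap)
    also have "\<dots> = (\<Sum>j=0..length p. \<Sum>k=0..length q. G j k (take (j + k) w) (drop (j + k) w))"
    proof (intro sum.cong refl)
      fix j k assume jk: "j \<in> {0..length p}" "k \<in> {0..length q}"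
      have "(\<Sum>i=0..n. G j k (take i w) (drop i w)) =
          (\<Sum>i=0..n. if i = j + k then G j k (take (j + k) w) (drop (j + k) w) else 0)"
      proof (intro sum.cong refl)
        fix i assume i: "i \<in> {0..n}"
        show "G j k (take i w) (drop i w) =
            (if i = j + k then G j k (take (j + k) w) (drop (j + k) w) else 0)"
        proof (cases "i = j + k")
          case False
          then have "length (take j p) + length (take k q) \<noteq> length (take i w)"
            using i jk w by auto
          then have "coeff2 (word_coproduct (take i w)) (take j p) (take k q) = 0"
            by (rule coeff2_word_coproduct_degree)
          then show ?thesis using False by (simp add: G_def)
        qed simp
      qed
      also have "\<dots> = G j k (take (j + k) w) (drop (j + k) w)"
        using jk by (simp add: n_def)
      finally show "(\<Sum>i=0..n. G j k (take i w) (drop i w)) =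
          G j k (take (j + k) w) (drop (j + k) w)" .
    qed
    finally show ?thesis .
  qed
  have "coeff2 (coproduct_series (x * y)) p q =
      (\<Sum>w | length w = n. \<Sum>j=0..length p. \<Sum>k=0..length q. G j k (take (j + k) w) (drop (j + k) w))"
    unfolding coeff2_coproduct_series by (intro sum.cong) (auto simp: n_def word)
  also have "\<dots> =
      (\<Sum>j=0..length p. \<Sum>w | length w = n. \<Sum>k=0..length q. G j k (take (j + k) w) (drop (j + k) w))"
    by (rule sum.swap)
  also have "\<dots> =
      (\<Sum>j=0..length p. \<Sum>k=0..length q. \<Sum>w | length w = n. G j k (take (j + k) w) (drop (j + k) w))"
    by (intro sum.cong refl sum.swap)
  also have "\<dots> = (\<Sum>j=0..length p. \<Sum>k=0..length q.
      \<Sum>u | length u = j + k. \<Sum>v | length v = n - (j + k). G j k u v)"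
    by (intro sum.cong refl sum_words_split) (auto simp: n_def)
  also have "\<dots> = (\<Sum>j=0..length p. \<Sum>k=0..length q.
      coeff2 (coproduct_series x) (take j p) (take k q) *
      coeff2 (coproduct_series y) (drop j p) (drop k q))"
  proof (intro sum.cong refl)
    fix j k assume jk: "j \<in> {0..length p}" "k \<in> {0..length q}"
    then have "length p - j + (length q - k) = n - (j + k)" by (auto simp: n_def)
    then show "(\<Sum>u | length u = j + k. \<Sum>v | length v = n - (j + k). G j k u v) =
      coeff2 (coproduct_series x) (take j p) (take k q) *
      coeff2 (coproduct_series y) (drop j p) (drop k q)"
      using jk unfolding coeff2_coproduct_series G_def sum_product by (simp add: min_def)
  qed
  also have "\<dots> = coeff2 (coproduct_series x * coproduct_series y) p q"
    by (rule coeff2_mult[symmetric])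
  finally show "coeff2 (coproduct_series (x * y)) p q =
      coeff2 (coproduct_series x * coproduct_series y) p q" .
qed

lemma is_coproduct_coproduct_series:
  "is_coproduct (coproduct_series :: ('v::finite, complex) ncps \<Rightarrow> 'v nc_tensor2)"
  unfolding is_coproduct_def
proof (intro conjI allI)
  fix x y :: "('v, complex) ncps" and c and v :: 'v
  show "coproduct_series (x + y) = coproduct_series x + coproduct_series y"
    by (intro ncps_eqI)
       (simp add: coeff2_coproduct_series nc_coeff_add distrib_right sum.distrib)
  show "coproduct_series (x * y) = coproduct_series x * coproduct_series y"
    by (rule coproduct_series_mult)
  show "coproduct_series (nc_const c :: ('v, complex) ncps) = nc_const (nc_const c)"
  proof (intro ncps_eqI)
    fix p q :: "'v list"
    have "coeff2 (coproduct_series (nc_const c)) p q =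
        (\<Sum>w :: 'v list | length w = length p + length q. if w = [] then c * coeff2 1 p q else 0)"
      unfolding coeff2_coproduct_series by (intro sum.cong refl) (simp add: nc_const_def)
    also have "\<dots> = coeff2 (nc_const (nc_const c)) p q"
      by (auto simp: finite_words nc_const_def nc_coeff_simps)
    finally show "coeff2 (coproduct_series (nc_const c)) p q = coeff2 (nc_const (nc_const c)) p q" .
  qed
  show "nc_continuous (coproduct_series :: ('v, complex) ncps \<Rightarrow> 'v nc_tensor2)"
    unfolding nc_continuous_def
  proof (intro allI exI impI)
    fix x y :: "('v, complex) ncps" and n
    assume "agree_below n x y"
    then show "agree_below2 n (coproduct_series x) (coproduct_series y)"
      unfolding agree_below_def agree_below2_def coeff2_coproduct_series
      by (auto intro!: sum.cong)
  qed
  show "coproduct_series (nc_var v) = nc_var v \<otimes>\<^sub>A 1 + 1 \<otimes>\<^sub>A nc_var v"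
  proof (intro ncps_eqI)
    fix p q
    have "coeff2 (coproduct_series (nc_var v)) p q =
      (\<Sum>w | length w = length p + length q. if w = [v] then coeff2 (word_coproduct [v]) p q else 0)"
      unfolding coeff2_coproduct_series by (intro sum.cong refl) (auto simp: nc_var_def)
    also have "\<dots> = coeff2 (word_coproduct [v]) p q"
      using coeff2_word_coproduct_degree[of p q "[v]"] by (auto simp: finite_words)
    finally show "coeff2 (coproduct_series (nc_var v)) p q =
        coeff2 (nc_var v \<otimes>\<^sub>A 1 + 1 \<otimes>\<^sub>A nc_var v) p q"
      by simp
  qed
qed

lemma is_coproduct_unique:
  fixes D :: "('v::finite, complex) ncps \<Rightarrow> 'v nc_tensor2"
  assumes D: "is_coproduct D" and E: "is_coproduct E"
  shows "D = E"
proof (intro ext ncps_eqI)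
  fix x :: "('v, complex) ncps" and p q :: "'v list"
  have word: "D (nc_word w) = E (nc_word w)" for w :: "'v list"
  proof (induction w)
    case Nil
    have "(1 :: ('v, complex) ncps) = nc_const 1" by (simp add: nc_const_def one_ncps_def)
    then show ?case using D E unfolding is_coproduct_def by (metis nc_word.simps(1))
  next
    case (Cons v w)
    then show ?case using D E unfolding is_coproduct_def by simp
  qed
  have zero: "D 0 = E 0"
  proof -
    have "D 0 = D 0 + D 0" "E 0 = E 0 + E 0"
      using D E unfolding is_coproduct_def by (metis add_0)+
    then show ?thesis by simp
  qed
  have fin: "D (\<Sum>w\<in>A. nc_const (c w) * nc_word w) = E (\<Sum>w\<in>A. nc_const (c w) * nc_word w)"
    if "finite A" for A and c :: "'v list \<Rightarrow> complex"
    using that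
    by (induction A rule: finite_induct) (use D E word zero in \<open>auto simp: is_coproduct_def\<close>)
  define n where "n = Suc (length p + length q)"
  obtain m1 m2 where m: "\<And>y. agree_below m1 x y \<Longrightarrow> agree_below2 n (D x) (D y)"
    "\<And>y. agree_below m2 x y \<Longrightarrow> agree_below2 n (E x) (E y)"
    using D E unfolding is_coproduct_def nc_continuous_def by metis
  define m where "m = max m1 m2"
  define A where "A = {w :: 'v list. length w \<le> m}"
  have A: "finite A"
    using finite_lists_length_le[of "UNIV :: 'v set" m] by (simp add: A_def)
  define y where "y = (\<Sum>w\<in>A. nc_const (nc_coeff x w) * nc_word w)"
  have "nc_coeff y w = nc_coeff x w" if "length w \<le> m" for w
  proof -
    have "nc_coeff y w = (\<Sum>u\<in>A. if u = w then nc_coeff x w else 0)"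
      unfolding y_def nc_coeff_sum nc_coeff_const_mult
      by (intro sum.cong refl) (auto simp: nc_coeff_word)
    then show ?thesis using that A by (simp add: A_def)
  qed
  then have "agree_below m1 x y" "agree_below m2 x y"
    by (auto simp: agree_below_def m_def)
  then have "agree_below2 n (D x) (D y)" "agree_below2 n (E x) (E y)"
    using m by auto
  moreover have "D y = E y" unfolding y_def by (rule fin[OF A])
  ultimately show "coeff2 (D x) p q = coeff2 (E x) p q"
    by (auto simp: agree_below2_def n_def)
qed

definition coproduct :: "('v, complex) ncps \<Rightarrow> 'v nc_tensor2" where
  "coproduct = (THE D. is_coproduct D)"

lemma is_coproduct_coproduct: "is_coproduct (coproduct :: ('v::finite, complex) ncps \<Rightarrow> 'v nc_tensor2)"
  unfolding coproduct_def
  by (rule theI[where P = is_coproduct, OF is_coproduct_coproduct_series])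
     (rule is_coproduct_unique[OF _ is_coproduct_coproduct_series])


section \<open>Riemann surfaces\<close>

type_synonym 'x chart = "'x set \<times> ('x \<Rightarrow> complex)"

definition complex_chart :: "'x topology \<Rightarrow> 'x chart \<Rightarrow> bool" where
  "complex_chart X = (\<lambda>(U, \<phi>). openin X U \<and> open (\<phi> ` U) \<and>
     homeomorphic_map (subtopology X U) (top_of_set (\<phi> ` U)) \<phi>)"

definition transition :: "'x chart \<Rightarrow> 'x chart \<Rightarrow> complex \<Rightarrow> complex" where
  "transition c d = (\<lambda>z. snd d (inv_into (fst c) (snd c) z))"

definition compatible :: "'x chart \<Rightarrow> 'x chart \<Rightarrow> bool" where
  "compatible c d \<longleftrightarrow>
     transition c d holomorphic_on snd c ` (fst c \<inter> fst d) \<and>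
     transition d c holomorphic_on snd d ` (fst c \<inter> fst d)"

text \<open>The complex structure is given by its maximal atlas, so that every local parameter is
  a chart of the atlas.\<close>

definition riemann_surface :: "'x topology \<Rightarrow> 'x chart set \<Rightarrow> bool" where
  "riemann_surface X \<A> \<longleftrightarrow>
     topspace X \<noteq> {} \<and> connected_space X \<and> Hausdorff_space X \<and>
     (\<forall>c\<in>\<A>. complex_chart X c) \<and> (\<Union>c\<in>\<A>. fst c) = topspace X \<and>
     (\<forall>c\<in>\<A>. \<forall>d\<in>\<A>. compatible c d) \<and>
     (\<forall>c. complex_chart X c \<and> (\<forall>d\<in>\<A>. compatible c d) \<longrightarrow> c \<in> \<A>)"

text \<open>The library's \<^const>\<open>simply_connected\<close>, transcribed to abstract topologies.\<close>

definition simply_connected_space :: "'x topology \<Rightarrow> bool" where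
  "simply_connected_space X \<longleftrightarrow>
     (\<forall>p q. pathin X p \<and> p 1 = p 0 \<and> pathin X q \<and> q 1 = q 0 \<longrightarrow>
        homotopic_with (\<lambda>h. h 1 = h 0) (top_of_set {0..1}) X p q)"

definition local_biholomorphism ::
    "'y topology \<Rightarrow> 'y chart set \<Rightarrow> 'x chart set \<Rightarrow> ('y \<Rightarrow> 'x) \<Rightarrow> bool" where
  "local_biholomorphism W \<B> \<A> p \<longleftrightarrow>
     (\<forall>y\<in>topspace W. \<exists>N U \<phi>. y \<in> N \<and> (U, \<phi>) \<in> \<A> \<and> p ` N \<subseteq> U \<and> (N, \<phi> \<circ> p) \<in> \<B>)"


section \<open>Meromorphic forms\<close>

text \<open>A form \<open>\<omega>\<close> is given by its local expressions: on the chart \<open>(U, \<phi>)\<close> it is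
  \<open>\<omega> (U, \<phi>) z dz\<close>. By \<^const>\<open>nicely_meromorphic_on\<close>, removable singularities are
  removed and the value at a pole is \<open>0\<close>, so the transformation rule also holds at poles.\<close>

type_synonym 'x form = "'x chart \<Rightarrow> complex \<Rightarrow> complex"

definition meromorphic_form :: "'x chart set \<Rightarrow> 'x form \<Rightarrow> bool" where
  "meromorphic_form \<A> \<omega> \<longleftrightarrow>
     (\<forall>c\<in>\<A>. \<omega> c nicely_meromorphic_on snd c ` fst c) \<and>
     (\<forall>c\<in>\<A>. \<forall>d\<in>\<A>. \<forall>z\<in>snd c ` (fst c \<inter> fst d).
        \<omega> c z = \<omega> d (transition c d z) * deriv (transition c d) z)"

definition at_most_log_singularity :: "'x chart set \<Rightarrow> 'x form \<Rightarrow> 'x \<Rightarrow> bool" where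
  "at_most_log_singularity \<A> \<omega> a \<longleftrightarrow>
     (\<forall>(U, \<phi>)\<in>\<A>. a \<in> U \<and> is_pole (\<omega> (U, \<phi>)) (\<phi> a) \<longrightarrow> zorder (\<omega> (U, \<phi>)) (\<phi> a) = - 1)"

text \<open>The residue of a form does not depend on the chart around \<open>a\<close> in which it is computed; it is
  taken below in the local parameter \<open>t\<close> at \<open>a\<close>.\<close>

definition form_residue :: "'x form \<Rightarrow> 'x chart \<Rightarrow> 'x \<Rightarrow> complex" where
  "form_residue \<omega> c a = residue (\<omega> c) (snd c a)"

definition nc_form :: "('v::finite \<Rightarrow> 'x form) \<Rightarrow> 'x chart \<Rightarrow> complex \<Rightarrow> ('v, complex) ncps" where
  "nc_form \<omega> c z = (\<Sum>v\<in>UNIV. nc_const (\<omega> v c z) * nc_var v)"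

definition nc_residue :: "('v::finite \<Rightarrow> 'x form) \<Rightarrow> 'x chart \<Rightarrow> 'x \<Rightarrow> ('v, complex) ncps" where
  "nc_residue \<omega> c a = (\<Sum>v\<in>UNIV. nc_const (form_residue (\<omega> v) c a) * nc_var v)"


section \<open>Horizontal sections and the scattering operator\<close>

definition local_expr ::
    "('x \<Rightarrow> ('v, complex) ncps) \<Rightarrow> 'x chart \<Rightarrow> 'v list \<Rightarrow> complex \<Rightarrow> complex" where
  "local_expr J c w = (\<lambda>z. nc_coeff (J (inv_into (fst c) (snd c) z)) w)"

definition holomorphic_section ::
    "'x chart set \<Rightarrow> 'x set \<Rightarrow> ('x \<Rightarrow> ('v, complex) ncps) \<Rightarrow> bool" where
  "holomorphic_section \<A> S J \<longleftrightarrow>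
     (\<forall>c\<in>\<A>. \<forall>w. local_expr J c w holomorphic_on snd c ` (fst c \<inter> S))"

definition horizontal_section ::
    "'x chart set \<Rightarrow> ('v::finite \<Rightarrow> 'x form) \<Rightarrow> 'x set \<Rightarrow> ('x \<Rightarrow> ('v, complex) ncps) \<Rightarrow> bool" where
  "horizontal_section \<A> \<omega> S J \<longleftrightarrow> holomorphic_section \<A> S J \<and>
     (\<forall>c\<in>\<A>. \<forall>x\<in>fst c \<inter> S. \<forall>w.
        deriv (local_expr J c w) (snd c x) = nc_coeff (nc_form \<omega> c (snd c x) * J x) w)"

definition regular_disc ::
    "'x chart set \<Rightarrow> ('v \<Rightarrow> 'x form) \<Rightarrow> 'x \<Rightarrow> 'x set \<Rightarrow> ('x \<Rightarrow> complex) \<Rightarrow> real \<Rightarrow> bool" where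
  "regular_disc \<A> \<omega> a U t r \<longleftrightarrow>
     (U, t) \<in> \<A> \<and> a \<in> U \<and> t a = 0 \<and> 0 < r \<and> t ` U = ball 0 r \<and>
     (\<forall>v. \<omega> v (U, t) holomorphic_on t ` (U - {a}))"

definition slit_disc ::
    "'x set \<Rightarrow> ('x \<Rightarrow> complex) \<Rightarrow> real \<Rightarrow> 'x set \<Rightarrow> bool" where
  "slit_disc U t r U' \<longleftrightarrow> (\<exists>\<gamma>. arc \<gamma> \<and> pathstart \<gamma> = 0 \<and> pathfinish \<gamma> \<in> sphere 0 r \<and>
     path_image \<gamma> - {pathfinish \<gamma>} \<subseteq> ball 0 r \<and>
     (\<forall>z\<in>path_image \<gamma> \<inter> ball 0 r. \<not> (Im z = 0 \<and> Re z > 0)) \<and>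
     U' = {x \<in> U. t x \<notin> path_image \<gamma>})"

definition log_branch :: "complex set \<Rightarrow> (complex \<Rightarrow> complex) \<Rightarrow> bool" where
  "log_branch S l \<longleftrightarrow> l holomorphic_on S \<and> (\<forall>z\<in>S. exp (l z) = z) \<and>
     (\<forall>z\<in>S. Im z = 0 \<and> Re z > 0 \<longrightarrow> l z \<in> \<real>)"

text \<open>\<open>K\<close> denotes both the section on \<open>U'\<close> and its extension to the neighbourhood \<open>N\<close> of \<open>a\<close>.\<close>

definition normalized_section ::
    "'x topology \<Rightarrow> 'x chart set \<Rightarrow> ('v::finite \<Rightarrow> 'x form) \<Rightarrow> 'x \<Rightarrow> 'x set \<Rightarrow> ('x \<Rightarrow> complex) \<Rightarrow>
     'x set \<Rightarrow> ('x \<Rightarrow> ('v, complex) ncps) \<Rightarrow> bool" where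
  "normalized_section X \<A> \<omega> a U t U' J \<longleftrightarrow>
     horizontal_section \<A> \<omega> U' J \<and>
     (\<exists>l K N. log_branch (t ` U') l \<and>
        openin X N \<and> a \<in> N \<and> holomorphic_section \<A> N K \<and> K a = 1 \<and>
        (\<forall>x\<in>U'. J x = K x * nc_exp (nc_residue \<omega> (U, t) a * nc_const (l (t x)))))"

text \<open>The simply connected domain is a Riemann surface \<open>W\<close> spread over \<open>X\<close> by a local
  biholomorphism \<open>p\<close>; a subdomain of \<open>X\<close> is the case where \<open>p\<close> and the embeddings are
  inclusions.\<close>

definition embedded_over ::
    "'x topology \<Rightarrow> 'y topology \<Rightarrow> ('y \<Rightarrow> 'x) \<Rightarrow> 'x set \<Rightarrow> ('x \<Rightarrow> 'y) \<Rightarrow> bool" where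
  "embedded_over X W p S e \<longleftrightarrow> embedding_map (subtopology X S) W e \<and> (\<forall>x\<in>S. p (e x) = x)"

definition analytic_continuation ::
    "'y topology \<Rightarrow> 'y chart set \<Rightarrow> 'x set \<Rightarrow> ('x \<Rightarrow> 'y) \<Rightarrow> ('x \<Rightarrow> ('v, complex) ncps) \<Rightarrow>
     ('y \<Rightarrow> ('v, complex) ncps) \<Rightarrow> bool" where
  "analytic_continuation W \<B> S e J F \<longleftrightarrow>
     holomorphic_section \<B> (topspace W) F \<and> (\<forall>x\<in>S. F (e x) = J x)"

definition scattering_operator ::
    "'y topology \<Rightarrow> ('y \<Rightarrow> ('v, complex) ncps) \<Rightarrow> ('y \<Rightarrow> ('v, complex) ncps) \<Rightarrow>
     ('v, complex) ncps" where
  "scattering_operator W Fa Fb =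
     (THE S. \<forall>y\<in>topspace W. nc_inverse (Fb y) * Fa y = S)"

end

theory Submission
  imports Defs
begin

text \<open>
  Since \<open>\<Omega>\<close> is linear in the variables, it is primitive. Hence for a horizontal section \<open>J\<close> both
  \<open>\<Delta>(J)\<close> and \<open>J \<otimes> J\<close> solve the linear equation \<open>dP = \<Delta>(\<Omega>) P\<close>, and one expects
  \<open>J\<close> to be group-like as soon as the normalizations agree. The normalization of
  \<open>J = K t\<^sup>R\<close> lives at a singular point, so the comparison is made for \<open>K\<close>: it satisfies
  \<open>dK = \<Omega> K - K R dlog t\<close> off the cut and is holomorphic across \<open>a\<close> with \<open>K(a) = 1\<close>. An
  equation of this shape in the completed tensor square has at most one solution with a given value
  at \<open>a\<close>: its coefficient forms have no term of degree zero, so by induction on the degree the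
  lowest coefficients of the difference of two solutions have derivative zero on an open set, hence
  are constant on the whole disc, hence vanish (\<open>tensor_ode_unique\<close>). So \<open>K\<close> is
  group-like; the same uniqueness, applied to \<open>s \<mapsto> exp(R s)\<close>, makes \<open>t\<^sup>R\<close> group-like,
  and therefore \<open>J\<close> is group-like near \<open>a\<close> (\<open>nc_grouplike_normalized\<close>).

  The identity theorem on the connected surface \<open>W\<close> (\<open>surface_propagation\<close>,
  \<open>holomorphic_vanishes\<close>) carries three properties of \<open>J\<close> from the image of the slit disc to the
  continuation \<open>F\<close> on all of \<open>W\<close>: constant term \<open>1\<close>, group-likeness, and
  horizontality (\<open>continuation_properties\<close>). For the last one the forms might a priori have
  poles on \<open>W\<close>; but the coefficient of \<open>F\<close> at the one-letter word \<open>v\<close> is a holomorphic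
  primitive of \<open>\<omega>\<^sub>v\<close> on an open set, so the identity theorem for meromorphic functions shows
  that the pulled back form is holomorphic throughout \<open>W\<close>.

  Finally two horizontal sections that agree at a point up to a right factor agree everywhere up to
  this factor (\<open>horizontal_right_multiple\<close>). Thus \<open>F\<^sub>b\<inverse> F\<^sub>a\<close> is a constant series, and as a
  product of group-like series it is group-like.
\<close>

section \<open>Constants, linear series and inverses\<close>

lemma nc_coeff_mult_const: "nc_coeff (x * nc_const c) w = nc_coeff x w * c"
proof -
  have "nc_coeff (x * nc_const c) w =
      (\<Sum>i=0..length w. if i = length w then nc_coeff x w * c else 0)"
    unfolding nc_coeff_mult by (intro sum.cong refl) (auto simp: nc_const_def)
  then show ?thesis by simp
qed

lemma nc_const_commute: "nc_const c * x = (x :: ('v, complex) ncps) * nc_const c"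
  by (intro ncps_eqI) (simp add: nc_coeff_const_mult nc_coeff_mult_const mult.commute)

lemma nc_const_mult: "nc_const c * nc_const d = nc_const (c * d)"
  by (intro ncps_eqI) (simp add: nc_coeff_mult_const, simp add: nc_const_def)

lemma nc_const_1: "nc_const 1 = 1"
  by (simp add: nc_const_def one_ncps_def)

lemma nc_coeff_mult_Nil: "nc_coeff (x * y) [] = nc_coeff x [] * nc_coeff y []"
  by (simp add: nc_coeff_mult)

definition nc_linear :: "('v::finite \<Rightarrow> complex) \<Rightarrow> ('v, complex) ncps" where
  "nc_linear c = (\<Sum>v\<in>UNIV. nc_const (c v) * nc_var v)"

text \<open>Left multiplication by a linear series consumes the first letter of a word. It turns horizontality
  into the recursion \<open>d f\<^sub>v\<^sub>u = \<omega>\<^sub>v f\<^sub>u\<close> over words.\<close>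

lemma nc_coeff_linear_mult:
  "nc_coeff (nc_linear c * x) w = (case w of [] \<Rightarrow> 0 | v # u \<Rightarrow> c v * nc_coeff x u)"
  unfolding nc_linear_def sum_distrib_right nc_coeff_sum mult.assoc nc_coeff_const_mult
    nc_coeff_var_mult
  by (auto split: list.split simp: if_distrib[of "\<lambda>x. _ * x"] cong: if_cong)

lemma nc_const_mult_linear: "nc_const c * nc_linear d = nc_linear (\<lambda>v. c * d v)"
  unfolding nc_linear_def sum_distrib_left mult.assoc[symmetric] nc_const_mult ..

text \<open>The inverse is the geometric series in \<open>1 - x\<close>, which has no constant term; in each degree
  only finitely many powers contribute.\<close>

lemma nc_right_inverse:
  fixes x :: "('v, complex) ncps"
  assumes "nc_coeff x [] = 1"
  shows "\<exists>y. x * y = 1 \<and> nc_coeff y [] = 1"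
proof -
  define d where "d = 1 - x"
  have d0: "nc_coeff d [] = 0" using assms by (simp add: d_def nc_coeff_simps)
  have low: "nc_coeff (d ^ n) w = 0" if "length w < n" for n and w :: "'v list"
    using that
  proof (induction n arbitrary: w)
    case (Suc n)
    show ?case
      unfolding power_Suc nc_coeff_mult
    proof (intro sum.neutral ballI)
      fix i assume "i \<in> {0..length w}"
      then show "nc_coeff d (take i w) * nc_coeff (d ^ n) (drop i w) = 0"
        using Suc d0 by (cases "i = 0") auto
    qed
  qed simp
  define Y where "Y = (\<lambda>N. \<Sum>n\<le>N. d ^ n)"
  define y where "y = Abs_ncps (\<lambda>w. nc_coeff (Y (length w)) w)"
  have xY: "x * Y N = 1 - d ^ Suc N" for N
  proof (induction N)
    case (Suc N)
    have "x * Y (Suc N) = x * Y N + x * d ^ Suc N" by (simp add: Y_def distrib_left)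
    also have "\<dots> = 1 - d ^ Suc (Suc N)"
      unfolding Suc by (simp add: d_def algebra_simps)
    finally show ?case .
  qed (simp add: Y_def d_def)
  have yY: "nc_coeff y w = nc_coeff (Y N) w" if "length w \<le> N" for w N
  proof -
    have "nc_coeff (Y N) w = (\<Sum>n\<le>length w. nc_coeff (d ^ n) w)"
      unfolding Y_def nc_coeff_sum using that
      by (intro sum.mono_neutral_right) (auto simp: low)
    then show ?thesis by (simp add: y_def Y_def nc_coeff_sum)
  qed
  have "x * y = 1"
  proof (rule ncps_eqI)
    fix w
    have "nc_coeff (x * y) w = nc_coeff (x * Y (length w)) w"
      unfolding nc_coeff_mult by (intro sum.cong refl) (simp add: yY)
    then show "nc_coeff (x * y) w = nc_coeff 1 w"
      by (simp add: xY nc_coeff_diff low del: power_Suc)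
  qed
  moreover from this have "nc_coeff y [] = 1"
    using assms nc_coeff_mult_Nil[of x y] by (simp add: nc_coeff_1)
  ultimately show ?thesis by blast
qed

lemma nc_inverse:
  fixes x :: "('v, complex) ncps"
  assumes "nc_coeff x [] = 1"
  shows nc_inverse_right: "x * nc_inverse x = 1" and nc_inverse_left: "nc_inverse x * x = 1"
proof -
  obtain y z where y: "x * y = 1" and z: "y * z = 1"
    using nc_right_inverse assms by metis
  have "z = x * y * z" by (simp add: y)
  also have "\<dots> = x" by (simp add: mult.assoc z)
  finally have yx: "y * x = 1" using z by simp
  have "y' = y" if "x * y' = 1" for y'
  proof -
    have "y' = y * x * y'" by (simp add: yx)
    also have "\<dots> = y" by (simp add: mult.assoc that)
    finally show ?thesis .
  qed
  with y yx have "\<exists>!y. x * y = 1 \<and> y * x = 1" by blast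
  then have "x * nc_inverse x = 1 \<and> nc_inverse x * x = 1"
    unfolding nc_inverse_def by (rule theI')
  then show "x * nc_inverse x = 1" "nc_inverse x * x = 1" by auto
qed


section \<open>Group-like and primitive series\<close>

lemma coproduct_eq_series: "coproduct = (coproduct_series :: ('v::finite, complex) ncps \<Rightarrow> _)"
  by (rule is_coproduct_unique[OF is_coproduct_coproduct is_coproduct_coproduct_series])

lemma
  fixes x y :: "('v::finite, complex) ncps"
  shows coproduct_add: "coproduct (x + y) = coproduct x + coproduct y"
    and coproduct_mult: "coproduct (x * y) = coproduct x * coproduct y"
    and coproduct_const: "coproduct (nc_const c :: ('v, complex) ncps) = nc_const (nc_const c)"
    and coproduct_var: "coproduct (nc_var v :: ('v, complex) ncps) = nc_var v \<otimes>\<^sub>A 1 + 1 \<otimes>\<^sub>A nc_var v"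
  using is_coproduct_coproduct[where 'v = 'v] unfolding is_coproduct_def by blast+

lemma coproduct_1: "coproduct (1 :: ('v::finite, complex) ncps) = 1"
  using coproduct_const[of 1] by (simp add: nc_const_1)

lemma coproduct_0: "coproduct (0 :: ('v::finite, complex) ncps) = 0"
  using coproduct_add[of 0 "0 :: ('v, complex) ncps"] by simp

lemma coproduct_diff:
  "coproduct (x - y :: ('v::finite, complex) ncps) = coproduct x - coproduct y"
  using coproduct_add[of "x - y" y] by (simp add: algebra_simps)

lemma tensor_1: "1 \<otimes>\<^sub>A 1 = 1"
  by (intro ncps_eqI) (auto simp: coeff2_tensor nc_coeff_simps)

lemma tensor_add_left: "(x + y) \<otimes>\<^sub>A z = x \<otimes>\<^sub>A z + y \<otimes>\<^sub>A z"
  and tensor_add_right: "z \<otimes>\<^sub>A (x + y) = z \<otimes>\<^sub>A x + z \<otimes>\<^sub>A y"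
  and tensor_diff_left: "(x - y) \<otimes>\<^sub>A z = x \<otimes>\<^sub>A z - y \<otimes>\<^sub>A z"
  and tensor_diff_right: "z \<otimes>\<^sub>A (x - y) = z \<otimes>\<^sub>A x - z \<otimes>\<^sub>A y"
  and tensor_0_left: "0 \<otimes>\<^sub>A z = 0" and tensor_0_right: "z \<otimes>\<^sub>A 0 = 0"
  by (intro ncps_eqI; simp add: coeff2_tensor nc_coeff_simps algebra_simps)+

definition nc_grouplike :: "('v, complex) ncps \<Rightarrow> bool" where
  "nc_grouplike x \<longleftrightarrow> coproduct x = x \<otimes>\<^sub>A x"

definition nc_primitive :: "('v, complex) ncps \<Rightarrow> bool" where
  "nc_primitive x \<longleftrightarrow> coproduct x = x \<otimes>\<^sub>A 1 + 1 \<otimes>\<^sub>A x"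

text \<open>Primitive series form a complex vector space that contains the variables.\<close>

lemma nc_primitive_linear: "nc_primitive (nc_linear c)"
proof -
  have add: "nc_primitive (x + y)" if "nc_primitive x" "nc_primitive y"
    for x y :: "('a, complex) ncps"
    using that by (simp add: nc_primitive_def coproduct_add tensor_add_left tensor_add_right)
  have var: "nc_primitive (nc_const d * nc_var v)" for d and v :: 'a
  proof -
    have scalar: "nc_const (nc_const d) = nc_const d \<otimes>\<^sub>A (1 :: ('a, complex) ncps)"
      "nc_const (nc_const d) = (1 :: ('a, complex) ncps) \<otimes>\<^sub>A nc_const d"
      by (intro ncps_eqI; simp add: coeff2_tensor nc_const_def nc_coeff_simps)+
    have "nc_const (nc_const d) * (nc_var v \<otimes>\<^sub>A 1) = (nc_const d * nc_var v) \<otimes>\<^sub>A 1"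
      by (simp only: scalar(1) tensor_mult mult_1_left)
    moreover have "nc_const (nc_const d) * (1 \<otimes>\<^sub>A nc_var v) = 1 \<otimes>\<^sub>A (nc_const d * nc_var v)"
      by (simp only: scalar(2) tensor_mult mult_1_left)
    ultimately show ?thesis
      by (simp add: nc_primitive_def coproduct_mult coproduct_const coproduct_var distrib_left)
  qed
  have "nc_primitive (\<Sum>v\<in>A. nc_const (c v) * nc_var v)" if "finite A" for A
    using that
  proof (induction A rule: finite_induct)
    case (insert v A)
    then show ?case using add[OF var] by simp
  qed (simp add: nc_primitive_def coproduct_0 tensor_0_left tensor_0_right)
  then show ?thesis by (simp add: nc_linear_def)
qed

lemma nc_grouplike_mult:
  fixes x y :: "('v::finite, complex) ncps"
  shows "nc_grouplike x \<Longrightarrow> nc_grouplike y \<Longrightarrow> nc_grouplike (x * y)"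
  by (simp add: nc_grouplike_def coproduct_mult tensor_mult)

text \<open>Apply the coproduct to \<open>x x\<inverse> = 1\<close> and cancel \<open>x \<otimes> x\<close>.\<close>

lemma nc_grouplike_inverse:
  fixes x :: "('v::finite, complex) ncps"
  assumes "nc_grouplike x" "nc_coeff x [] = 1"
  shows "nc_grouplike (nc_inverse x)"
proof -
  let ?y = "nc_inverse x"
  have "coproduct ?y = (?y \<otimes>\<^sub>A ?y) * (x \<otimes>\<^sub>A x) * coproduct ?y"
    by (simp add: tensor_mult nc_inverse_left assms(2) tensor_1)
  also have "\<dots> = (?y \<otimes>\<^sub>A ?y) * coproduct (x * ?y)"
    using assms(1) by (simp add: nc_grouplike_def coproduct_mult mult.assoc)
  also have "\<dots> = ?y \<otimes>\<^sub>A ?y"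
    by (simp add: nc_inverse_right assms(2) coproduct_1)
  finally show ?thesis by (simp add: nc_grouplike_def)
qed


section \<open>Differential equations for series\<close>

definition nc_has_deriv ::
    "(complex \<Rightarrow> ('v, complex) ncps) \<Rightarrow> ('v, complex) ncps \<Rightarrow> complex \<Rightarrow> bool" where
  "nc_has_deriv f f' z \<longleftrightarrow>
     (\<forall>w. ((\<lambda>z. nc_coeff (f z) w) has_field_derivative nc_coeff f' w) (at z))"

definition tensor_has_deriv ::
    "(complex \<Rightarrow> 'v nc_tensor2) \<Rightarrow> 'v nc_tensor2 \<Rightarrow> complex \<Rightarrow> bool" where
  "tensor_has_deriv f f' z \<longleftrightarrow>
     (\<forall>p q. ((\<lambda>z. coeff2 (f z) p q) has_field_derivative coeff2 f' p q) (at z))"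

lemma nc_has_deriv_mult:
  assumes "nc_has_deriv f f' z" "nc_has_deriv g g' z"
  shows "nc_has_deriv (\<lambda>z. f z * g z) (f' * g z + f z * g') z"
  unfolding nc_has_deriv_def
proof
  fix w
  have D: "((\<lambda>z. nc_coeff (f z) u) has_field_derivative nc_coeff f' u) (at z)"
    "((\<lambda>z. nc_coeff (g z) u) has_field_derivative nc_coeff g' u) (at z)" for u
    using assms by (auto simp: nc_has_deriv_def)
  have "((\<lambda>z. nc_coeff (f z * g z) w) has_field_derivative
      (\<Sum>i=0..length w. nc_coeff f' (take i w) * nc_coeff (g z) (drop i w) +
         nc_coeff (f z) (take i w) * nc_coeff g' (drop i w))) (at z)"
    unfolding nc_coeff_mult by (intro DERIV_sum) (auto intro!: derivative_eq_intros D)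
  then show "((\<lambda>z. nc_coeff (f z * g z) w) has_field_derivative
      nc_coeff (f' * g z + f z * g') w) (at z)"
    by (simp add: nc_coeff_add nc_coeff_mult sum.distrib)
qed

lemma nc_has_deriv_diff:
  "nc_has_deriv f f' z \<Longrightarrow> nc_has_deriv g g' z \<Longrightarrow> nc_has_deriv (\<lambda>z. f z - g z) (f' - g') z"
  unfolding nc_has_deriv_def nc_coeff_diff by (auto intro: DERIV_diff)

lemma nc_has_deriv_compose:
  assumes "nc_has_deriv f f' (l z)" "(l has_field_derivative l') (at z)"
  shows "nc_has_deriv (\<lambda>z. f (l z)) (nc_const l' * f') z"
  unfolding nc_has_deriv_def
proof
  fix w
  have "((\<lambda>z. nc_coeff (f (l z)) w) has_field_derivative nc_coeff f' w * l') (at z)"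
    using assms by (intro DERIV_chain2[of "\<lambda>s. nc_coeff (f s) w"]) (auto simp: nc_has_deriv_def)
  then show "((\<lambda>z. nc_coeff (f (l z)) w) has_field_derivative nc_coeff (nc_const l' * f') w) (at z)"
    by (simp add: nc_coeff_const_mult mult.commute)
qed

lemma nc_has_deriv_transform:
  assumes "nc_has_deriv f f' z" "open S" "z \<in> S" "\<And>x. x \<in> S \<Longrightarrow> f x = g x"
  shows "nc_has_deriv g f' z"
  unfolding nc_has_deriv_def
proof
  fix w
  show "((\<lambda>z. nc_coeff (g z) w) has_field_derivative nc_coeff f' w) (at z)"
    by (rule has_field_derivative_transform_within_open[of "\<lambda>z. nc_coeff (f z) w", OF _ assms(2,3)])
       (use assms in \<open>auto simp: nc_has_deriv_def\<close>)
qed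

lemma nc_has_deriv_unique: "nc_has_deriv f f' z \<Longrightarrow> nc_has_deriv f f'' z \<Longrightarrow> f' = f''"
  unfolding nc_has_deriv_def ncps_eq_iff by (blast intro: DERIV_unique)

lemma tensor_has_deriv_coproduct:
  fixes f :: "complex \<Rightarrow> ('v::finite, complex) ncps"
  assumes "nc_has_deriv f f' z"
  shows "tensor_has_deriv (\<lambda>z. coproduct (f z)) (coproduct f') z"
  using assms unfolding tensor_has_deriv_def nc_has_deriv_def coproduct_eq_series
    coeff2_coproduct_series
  by (auto intro!: DERIV_sum DERIV_cmult_right)

lemma tensor_has_deriv_square:
  assumes "nc_has_deriv f f' z"
  shows "tensor_has_deriv (\<lambda>z. f z \<otimes>\<^sub>A f z) (f' \<otimes>\<^sub>A f z + f z \<otimes>\<^sub>A f') z"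
  unfolding tensor_has_deriv_def
proof (intro allI)
  fix p q
  have D: "((\<lambda>z. nc_coeff (f z) u) has_field_derivative nc_coeff f' u) (at z)" for u
    using assms by (auto simp: nc_has_deriv_def)
  show "((\<lambda>z. coeff2 (f z \<otimes>\<^sub>A f z) p q) has_field_derivative
      coeff2 (f' \<otimes>\<^sub>A f z + f z \<otimes>\<^sub>A f') p q) (at z)"
    unfolding coeff2_tensor nc_coeff_add by (auto intro!: derivative_eq_intros D)
qed

text \<open>The derivative vanishes on all of \<open>D\<close> by the identity theorem. Allowing a smaller set \<open>T\<close> matters
  because the differential equations below hold only off a cut, whereas the initial value is
  prescribed at the end point of the cut.\<close>

lemma holomorphic_deriv_zero_constant:
  assumes "open D" "connected D" "f holomorphic_on D" "open T" "T \<noteq> {}" "T \<subseteq> D"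
    and "\<And>z. z \<in> T \<Longrightarrow> (f has_field_derivative 0) (at z)"
    and "z \<in> D" "z' \<in> D"
  shows "f z = f z'"
proof -
  have "deriv f z = 0" if "z \<in> D" for z
    by (rule analytic_continuation_open[of T D "deriv f" "\<lambda>_. 0"])
       (use assms that in \<open>auto intro!: holomorphic_deriv DERIV_imp_deriv\<close>)
  then have "(f has_field_derivative 0) (at z)" if "z \<in> D" for z
    using holomorphic_derivI[OF assms(3,1) that] that by simp
  then obtain c where "\<And>z. z \<in> D \<Longrightarrow> f z = c"
    using DERIV_zero_connected_constant[of D "{}" f] assms(1-3)
    by (metis Diff_empty finite.emptyI holomorphic_on_imp_continuous_on)
  then show ?thesis using assms by simp
qed

lemma coeff2_diff: "coeff2 (S - T) p q = coeff2 S p q - coeff2 T p q"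
  by (simp add: nc_coeff_diff)

text \<open>In the coefficient of \<open>u \<otimes> w\<close> the right-hand side \<open>A E - E B\<close> of the equation for the difference
  \<open>E = P - Q\<close> involves only coefficients of \<open>E\<close> of smaller total degree, because \<open>A\<close> and \<open>B\<close> have no
  constant term. So the coefficients of \<open>E\<close> vanish one degree after the other.\<close>

lemma tensor_ode_unique:
  fixes P Q A B :: "complex \<Rightarrow> 'v nc_tensor2"
  assumes D: "open D" "connected D" "z0 \<in> D" and T: "open T" "T \<noteq> {}" "T \<subseteq> D"
    and P: "\<And>p q. (\<lambda>z. coeff2 (P z) p q) holomorphic_on D"
    and Q: "\<And>p q. (\<lambda>z. coeff2 (Q z) p q) holomorphic_on D"
    and dP: "\<And>z. z \<in> T \<Longrightarrow> tensor_has_deriv P (A z * P z - P z * B z) z"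
    and dQ: "\<And>z. z \<in> T \<Longrightarrow> tensor_has_deriv Q (A z * Q z - Q z * B z) z"
    and A: "\<And>z. z \<in> T \<Longrightarrow> coeff2 (A z) [] [] = 0"
    and B: "\<And>z. z \<in> T \<Longrightarrow> coeff2 (B z) [] [] = 0"
    and init: "P z0 = Q z0" and z: "z \<in> D"
  shows "P z = Q z"
proof -
  define E where "E = (\<lambda>z. P z - Q z)"
  have "coeff2 (E z) p q = 0" if "z \<in> D" for z p q
    using that
  proof (induction "length p + length q" arbitrary: p q z rule: less_induct)
    case less
    have "((\<lambda>z. coeff2 (E z) p q) has_field_derivative 0) (at z)" if "z \<in> T" for z
    proof -
      have E': "A z * E z - E z * B z = (A z * P z - P z * B z) - (A z * Q z - Q z * B z)"
        by (simp add: E_def algebra_simps)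
      have "coeff2 (A z * E z) p q = 0"
        unfolding coeff2_mult
      proof (intro sum.neutral ballI)
        fix j k assume "j \<in> {0..length p}" "k \<in> {0..length q}"
        then show "coeff2 (A z) (take j p) (take k q) * coeff2 (E z) (drop j p) (drop k q) = 0"
          using less.hyps[of "drop j p" "drop k q" z] A[OF that] subsetD[OF T(3) that]
          by (cases "j = 0 \<and> k = 0") fastforce+
      qed
      moreover have "coeff2 (E z * B z) p q = 0"
        unfolding coeff2_mult
      proof (intro sum.neutral ballI)
        fix j k assume "j \<in> {0..length p}" "k \<in> {0..length q}"
        then show "coeff2 (E z) (take j p) (take k q) * coeff2 (B z) (drop j p) (drop k q) = 0"
          using less.hyps[of "take j p" "take k q" z] B[OF that] subsetD[OF T(3) that]
          by (cases "j = length p \<and> k = length q") fastforce+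
      qed
      ultimately have "coeff2 (A z * P z - P z * B z) p q - coeff2 (A z * Q z - Q z * B z) p q = 0"
        unfolding coeff2_diff[symmetric] E'[symmetric] by (simp add: coeff2_diff)
      moreover have "((\<lambda>z. coeff2 (E z) p q) has_field_derivative
          coeff2 (A z * P z - P z * B z) p q - coeff2 (A z * Q z - Q z * B z) p q) (at z)"
        unfolding E_def coeff2_diff[of "P _"] using dP[OF that] dQ[OF that]
        unfolding tensor_has_deriv_def by (intro DERIV_diff) auto
      ultimately show ?thesis by simp
    qed
    moreover have "(\<lambda>z. coeff2 (E z) p q) holomorphic_on D"
      unfolding E_def coeff2_diff by (intro holomorphic_intros P Q)
    ultimately have "coeff2 (E z) p q = coeff2 (E z0) p q"
      by (intro holomorphic_deriv_zero_constant[OF D(1,2) _ T]) (use D less.prems in auto)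
    then show ?case using init by (simp add: E_def nc_coeff_simps)
  qed
  then show ?thesis using z by (intro ncps_eqI) (simp add: E_def coeff2_diff)
qed

text \<open>Both \<open>\<Delta>(K)\<close> and \<open>K \<otimes> K\<close> solve the equation with \<open>\<Delta>(\<alpha>)\<close> and \<open>\<Delta>(\<beta>)\<close> in place of \<open>\<alpha>\<close> and \<open>\<beta>\<close>; for
  \<open>K \<otimes> K\<close> this is the Leibniz rule together with the primitivity of linear series.\<close>

lemma nc_ode_grouplike:
  fixes K :: "complex \<Rightarrow> ('v::finite, complex) ncps"
  assumes D: "open D" "connected D" "z0 \<in> D" and T: "open T" "T \<noteq> {}" "T \<subseteq> D"
    and K: "\<And>w. (\<lambda>z. nc_coeff (K z) w) holomorphic_on D" "K z0 = 1"
    and dK: "\<And>z. z \<in> T \<Longrightarrow>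
      nc_has_deriv K (nc_linear (\<alpha> z) * K z - K z * nc_linear (\<beta> z)) z"
    and z: "z \<in> D"
  shows "nc_grouplike (K z)"
  unfolding nc_grouplike_def
proof (rule tensor_ode_unique[OF D T, where A = "\<lambda>z. coproduct (nc_linear (\<alpha> z))"
      and B = "\<lambda>z. coproduct (nc_linear (\<beta> z))"])
  have prim: "coproduct (nc_linear c) = nc_linear c \<otimes>\<^sub>A 1 + 1 \<otimes>\<^sub>A nc_linear c"
    for c :: "'v \<Rightarrow> complex"
    using nc_primitive_linear by (simp add: nc_primitive_def)
  have lin0: "nc_coeff (nc_linear c) [] = 0" for c :: "'v \<Rightarrow> complex"
    using nc_coeff_linear_mult[of c 1 "[]"] by simp
  fix p q
  show "(\<lambda>z. coeff2 (coproduct (K z)) p q) holomorphic_on D"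
    unfolding coproduct_eq_series coeff2_coproduct_series by (intro holomorphic_intros K)
  show "(\<lambda>z. coeff2 (K z \<otimes>\<^sub>A K z) p q) holomorphic_on D"
    unfolding coeff2_tensor by (intro holomorphic_intros K)
  show "coproduct (K z0) = K z0 \<otimes>\<^sub>A K z0"
    by (simp add: K coproduct_1 tensor_1)
  show "z \<in> D" by fact
  fix z assume z: "z \<in> T"
  let ?\<alpha> = "nc_linear (\<alpha> z)" and ?\<beta> = "nc_linear (\<beta> z)"
  show "tensor_has_deriv (\<lambda>z. coproduct (K z))
      (coproduct ?\<alpha> * coproduct (K z) - coproduct (K z) * coproduct ?\<beta>) z"
    using tensor_has_deriv_coproduct[OF dK[OF z]] by (simp add: coproduct_diff coproduct_mult)
  have "(?\<alpha> * K z - K z * ?\<beta>) \<otimes>\<^sub>A K z + K z \<otimes>\<^sub>A (?\<alpha> * K z - K z * ?\<beta>) =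
      coproduct ?\<alpha> * (K z \<otimes>\<^sub>A K z) - (K z \<otimes>\<^sub>A K z) * coproduct ?\<beta>"
    by (simp add: prim tensor_diff_left tensor_diff_right distrib_left distrib_right tensor_mult)
  then show "tensor_has_deriv (\<lambda>z. K z \<otimes>\<^sub>A K z)
      (coproduct ?\<alpha> * (K z \<otimes>\<^sub>A K z) - (K z \<otimes>\<^sub>A K z) * coproduct ?\<beta>) z"
    using tensor_has_deriv_square[OF dK[OF z]] by simp
  show "coeff2 (coproduct ?\<alpha>) [] [] = 0" "coeff2 (coproduct ?\<beta>) [] [] = 0"
    by (simp_all add: prim nc_coeff_add coeff2_tensor lin0)
qed

lemma nc_power_const: "(x * nc_const s) ^ n = (x :: ('v, complex) ncps) ^ n * nc_const (s ^ n)"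
proof (induction n)
  case (Suc n)
  have "(x * nc_const s) ^ Suc n = x * (nc_const s * x ^ n) * nc_const (s ^ n)"
    by (simp add: Suc mult.assoc)
  also have "\<dots> = x ^ Suc n * (nc_const s * nc_const (s ^ n))"
    by (subst nc_const_commute) (simp add: mult.assoc)
  finally show ?case by (simp add: nc_const_mult)
qed (simp add: nc_const_1)

text \<open>The \<open>n\<close>-th power of a linear series is homogeneous of degree \<open>n\<close>, so only one summand of the
  exponential series contributes to a given word.\<close>

lemma nc_coeff_exp_linear:
  "nc_coeff (nc_exp (nc_linear c * nc_const s)) w =
     nc_coeff (nc_linear c ^ length w) w * s ^ length w / fact (length w)"
proof -
  have deg: "nc_coeff (nc_linear c ^ n) w = 0" if "n \<noteq> length w" for n
    using that
    by (induction n arbitrary: w) (auto simp: nc_coeff_1 nc_coeff_linear_mult split: list.split)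
  have "(\<Sum>n. nc_coeff ((nc_linear c * nc_const s) ^ n) w / fact n) =
      (\<Sum>n\<in>{length w}. nc_coeff ((nc_linear c * nc_const s) ^ n) w / fact n)"
    by (intro suminf_finite) (auto simp: nc_power_const nc_coeff_mult_const deg)
  then show ?thesis by (simp add: nc_exp_def nc_power_const nc_coeff_mult_const)
qed

lemma nc_has_deriv_exp_linear:
  "nc_has_deriv (\<lambda>s. nc_exp (nc_linear c * nc_const s))
     (nc_linear c * nc_exp (nc_linear c * nc_const s)) s"
  unfolding nc_has_deriv_def
proof
  fix w
  show "((\<lambda>s. nc_coeff (nc_exp (nc_linear c * nc_const s)) w) has_field_derivative
      nc_coeff (nc_linear c * nc_exp (nc_linear c * nc_const s)) w) (at s)"
  proof (cases w)
    case (Cons v u)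
    define k where "k = c v * nc_coeff (nc_linear c ^ length u) u"
    have "((\<lambda>s. k * s ^ Suc (length u) / fact (Suc (length u))) has_field_derivative
        k * s ^ length u / fact (length u)) (at s)"
      by (auto intro!: derivative_eq_intros simp: field_simps simp del: power_Suc of_nat_Suc)
    then show ?thesis
      by (simp add: Cons nc_coeff_exp_linear nc_coeff_linear_mult k_def mult.assoc del: fact_Suc)
  qed (simp add: nc_coeff_exp_linear nc_coeff_linear_mult)
qed

lemma nc_coeff_exp_linear_Nil: "nc_coeff (nc_exp (nc_linear c * nc_const s)) [] = 1"
  by (simp add: nc_coeff_exp_linear nc_coeff_1)

lemma nc_linear_0: "nc_linear (\<lambda>_. 0) = 0"
  by (rule ncps_eqI) (simp add: nc_linear_def nc_coeff_sum nc_coeff_const_mult nc_coeff_0)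

lemma nc_grouplike_exp_linear: "nc_grouplike (nc_exp (nc_linear c * nc_const s))"
proof -
  define E where "E = (\<lambda>s. nc_exp (nc_linear c * nc_const s))"
  have init: "E 0 = 1"
  proof (rule ncps_eqI)
    fix w show "nc_coeff (E 0) w = nc_coeff 1 w"
      by (cases w) (simp_all add: E_def nc_coeff_exp_linear nc_coeff_1)
  qed
  have d: "nc_has_deriv E (nc_linear c * E z - E z * nc_linear (\<lambda>_. 0)) z" for z
    unfolding E_def nc_linear_0 mult_zero_right diff_zero by (rule nc_has_deriv_exp_linear)
  have hol: "(\<lambda>s. nc_coeff (E s) w) holomorphic_on UNIV" for w
    using d unfolding nc_has_deriv_def holomorphic_on_def by (metis field_differentiable_def)
  have "nc_grouplike (E s)"
    by (rule nc_ode_grouplike[OF _ _ _ open_UNIV _ _ hol init d]) (simp_all add: connected_UNIV)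
  then show ?thesis by (simp add: E_def)
qed

text \<open>Cancelling the invertible factor \<open>t\<^sup>R = exp(R l)\<close> in the equation for \<open>J = K t\<^sup>R\<close> gives
  \<open>K' = \<alpha> K - K R l'\<close>, which has the shape required for \<open>K\<close> to be group-like.\<close>

lemma nc_grouplike_normalized:
  fixes J K :: "complex \<Rightarrow> ('v::finite, complex) ncps"
  assumes D: "open D" "connected D" "z0 \<in> D" and T: "open T" "T \<noteq> {}" "T \<subseteq> D"
    and K: "\<And>w. (\<lambda>z. nc_coeff (K z) w) holomorphic_on D" "K z0 = 1"
    and l: "l holomorphic_on T"
    and J: "\<And>z. z \<in> T \<Longrightarrow> J z = K z * nc_exp (nc_linear c * nc_const (l z))"
    and dJ: "\<And>z. z \<in> T \<Longrightarrow> nc_has_deriv J (nc_linear (\<alpha> z) * J z) z"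
    and z: "z \<in> T"
  shows "nc_grouplike (J z)" and "nc_coeff (J z) [] = 1"
proof -
  define E where "E = (\<lambda>z. nc_exp (nc_linear c * nc_const (l z)))"
  define \<beta> where "\<beta> = (\<lambda>z v. deriv l z * c v)"
  have E0: "nc_coeff (E z) [] = 1" for z
    by (simp add: E_def nc_coeff_exp_linear_Nil)
  have dK: "nc_has_deriv K (nc_linear (\<alpha> z) * K z - K z * nc_linear (\<beta> z)) z" if z: "z \<in> T" for z
  proof -
    define K' where "K' = Abs_ncps (\<lambda>w. deriv (\<lambda>z. nc_coeff (K z) w) z)"
    have K': "nc_has_deriv K K' z"
      unfolding nc_has_deriv_def K'_def
      using holomorphic_derivI[OF K(1) D(1)] z T(3) by auto
    have "nc_has_deriv E (nc_const (deriv l z) * (nc_linear c * E z)) z"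
      unfolding E_def
      by (rule nc_has_deriv_compose[OF nc_has_deriv_exp_linear])
         (rule holomorphic_derivI[OF l T(1) z])
    then have "nc_has_deriv E (nc_linear (\<beta> z) * E z) z"
      by (simp add: \<beta>_def nc_const_mult_linear flip: mult.assoc)
    from nc_has_deriv_mult[OF K' this]
    have KE: "nc_has_deriv (\<lambda>z. K z * E z) (K' * E z + K z * (nc_linear (\<beta> z) * E z)) z" .
    have "nc_has_deriv (\<lambda>z. K z * E z) (nc_linear (\<alpha> z) * J z) z"
      by (rule nc_has_deriv_transform[OF dJ[OF z] T(1) z]) (simp add: J E_def)
    with KE have "nc_linear (\<alpha> z) * J z = K' * E z + K z * (nc_linear (\<beta> z) * E z)"
      by (rule nc_has_deriv_unique[rotated])
    then have "K' * E z = (nc_linear (\<alpha> z) * K z - K z * nc_linear (\<beta> z)) * E z"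
      using J[OF z] by (simp add: E_def algebra_simps)
    then have "K' * (E z * nc_inverse (E z)) =
        (nc_linear (\<alpha> z) * K z - K z * nc_linear (\<beta> z)) * (E z * nc_inverse (E z))"
      unfolding mult.assoc[symmetric] by simp
    then show ?thesis using K' by (simp add: nc_inverse_right[OF E0])
  qed
  have "nc_grouplike (K z)"
    by (rule nc_ode_grouplike[OF D T K dK]) (use z T in auto)
  then show "nc_grouplike (J z)"
    unfolding J[OF z] by (rule nc_grouplike_mult[OF _ nc_grouplike_exp_linear])
  \<comment> \<open>The constant term of \<open>J\<close> is that of \<open>K\<close>, which has derivative zero and the value \<open>1\<close> at \<open>z0\<close>.\<close>
  have "((\<lambda>z. nc_coeff (K z) []) has_field_derivative 0) (at z)" if "z \<in> T" for z
  proof -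
    have "nc_coeff (nc_linear (\<beta> z)) [] = 0" using nc_coeff_linear_mult[of "\<beta> z" 1 "[]"] by simp
    then have "nc_coeff (nc_linear (\<alpha> z) * K z - K z * nc_linear (\<beta> z)) [] = 0"
      by (simp add: nc_coeff_diff nc_coeff_linear_mult nc_coeff_mult_Nil[of "K z"])
    then show ?thesis using dK[OF that] unfolding nc_has_deriv_def by metis
  qed
  then have "nc_coeff (K z) [] = nc_coeff (K z0) []"
    by (intro holomorphic_deriv_zero_constant[OF D(1,2) K(1) T]) (use z D T in auto)
  then show "nc_coeff (J z) [] = 1"
    using J[OF z] E0 K(2) by (simp add: nc_coeff_mult_Nil E_def nc_coeff_1)
qed


section \<open>Charts and analytic continuation on a Riemann surface\<close>

lemma complex_chart_facts:
  assumes "complex_chart X c"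
  shows chart_openin: "openin X (fst c)"
    and chart_inj: "inj_on (snd c) (fst c)"
    and chart_open_image: "openin X S \<Longrightarrow> open (snd c ` (fst c \<inter> S))"
    and chart_openin_vimage: "open D \<Longrightarrow> openin X {x \<in> fst c. snd c x \<in> D}"
proof -
  obtain U \<phi> where c: "c = (U, \<phi>)" by (cases c)
  have U: "openin X U" and im: "open (\<phi> ` U)"
    and h: "homeomorphic_map (subtopology X U) (top_of_set (\<phi> ` U)) \<phi>"
    using assms by (auto simp: complex_chart_def c)
  have top: "topspace (subtopology X U) = U"
    using U by (meson openin_subset topspace_subtopology_subset)
  show "openin X (fst c)" using U by (simp add: c)
  show "inj_on (snd c) (fst c)"
    using homeomorphic_imp_injective_map[OF h] unfolding top by (simp add: c)
  show "open (snd c ` (fst c \<inter> S))" if "openin X S"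
  proof -
    have "openin (subtopology X U) (U \<inter> S)"
      using that by (simp add: openin_subtopology_Int2)
    then have "openin (top_of_set (\<phi> ` U)) (\<phi> ` (U \<inter> S))"
      using homeomorphic_imp_open_map[OF h] by (simp add: open_map_def)
    then show ?thesis using im by (simp add: c openin_open_eq)
  qed
  show "openin X {x \<in> fst c. snd c x \<in> D}" if "open D"
  proof -
    have "openin (subtopology X U) {x \<in> U. \<phi> x \<in> \<phi> ` U \<inter> D}"
      using openin_continuous_map_preimage[OF homeomorphic_imp_continuous_map[OF h],
          of "\<phi> ` U \<inter> D"] that unfolding top by (simp add: openin_open_Int)
    moreover have "{x \<in> U. \<phi> x \<in> \<phi> ` U \<inter> D} = {x \<in> U. \<phi> x \<in> D}" by auto
    ultimately show ?thesis
      using U by (simp add: c openin_open_subtopology)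
  qed
qed

lemma riemann_surface_chart: "riemann_surface X \<A> \<Longrightarrow> c \<in> \<A> \<Longrightarrow> complex_chart X c"
  by (simp add: riemann_surface_def)

lemma riemann_surface_chart_at:
  assumes "riemann_surface X \<A>" "x \<in> topspace X"
  shows "\<exists>c\<in>\<A>. x \<in> fst c"
  using assms unfolding riemann_surface_def by blast

lemma chart_inverse:
  "complex_chart X c \<Longrightarrow> x \<in> fst c \<Longrightarrow> inv_into (fst c) (snd c) (snd c x) = x"
  by (simp add: chart_inj)

lemma chart_ball:
  assumes "complex_chart X c" "x \<in> fst c" "openin X S" "x \<in> S"
  obtains r where "r > 0" "ball (snd c x) r \<subseteq> snd c ` (fst c \<inter> S)"
  using chart_open_image[OF assms(1,3)] assms(2,4) unfolding open_contains_ball by blast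

text \<open>An abstract identity theorem. The set of points near which \<open>Q\<close> holds is open; it is closed
  because a disc in a chart around a limit point meets it in an open set, from which \<open>Q\<close> spreads to
  the whole disc. Connectedness of \<open>W\<close> does the rest.\<close>

lemma surface_propagation:
  assumes W: "riemann_surface W \<B>"
    and step: "\<And>y. y \<in> topspace W \<Longrightarrow> \<exists>c\<in>\<B>. y \<in> fst c \<and>
      (\<forall>D T. open D \<and> connected D \<and> D \<subseteq> snd c ` fst c \<and> open T \<and> T \<noteq> {} \<and> T \<subseteq> D \<and>
         (\<forall>x\<in>fst c. snd c x \<in> T \<longrightarrow> Q x) \<longrightarrow> (\<forall>x\<in>fst c. snd c x \<in> D \<longrightarrow> Q x))"
    and M: "openin W M" "M \<noteq> {}" "\<And>x. x \<in> M \<Longrightarrow> Q x"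
    and y: "y \<in> topspace W"
  shows "Q y"
proof -
  define G where "G = \<Union>{S. openin W S \<and> (\<forall>x\<in>S. Q x)}"
  have G: "openin W G" unfolding G_def by (intro openin_Union) auto
  have "\<exists>N. openin W N \<and> y \<in> N \<and> N \<subseteq> topspace W - G" if y: "y \<in> topspace W - G" for y
  proof -
    obtain c where c: "c \<in> \<B>" "y \<in> fst c"
      and cont: "\<And>D T. \<lbrakk>open D; connected D; D \<subseteq> snd c ` fst c; open T; T \<noteq> {}; T \<subseteq> D;
          \<And>x. x \<in> fst c \<Longrightarrow> snd c x \<in> T \<Longrightarrow> Q x\<rbrakk> \<Longrightarrow> \<forall>x\<in>fst c. snd c x \<in> D \<longrightarrow> Q x"
      using step[of y] y by (metis DiffD1)
    note ch = riemann_surface_chart[OF W c(1)]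
    obtain r where r: "r > 0" "ball (snd c y) r \<subseteq> snd c ` (fst c \<inter> topspace W)"
      using chart_ball[OF ch c(2) openin_topspace] y by blast
    define N where "N = {x \<in> fst c. snd c x \<in> ball (snd c y) r}"
    have N: "openin W N" unfolding N_def by (rule chart_openin_vimage[OF ch]) simp
    have "N \<inter> G = {}"
    proof (rule ccontr)
      assume ne: "N \<inter> G \<noteq> {}"
      have "\<forall>x\<in>fst c. snd c x \<in> ball (snd c y) r \<longrightarrow> Q x"
      proof (rule cont)
        show "open (snd c ` (fst c \<inter> (N \<inter> G)))"
          by (rule chart_open_image[OF ch]) (use N G in blast)
        show "snd c ` (fst c \<inter> (N \<inter> G)) \<noteq> {}" using ne by (auto simp: N_def)
        show "snd c ` (fst c \<inter> (N \<inter> G)) \<subseteq> ball (snd c y) r" by (auto simp: N_def)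
        show "ball (snd c y) r \<subseteq> snd c ` fst c" using r by blast
        fix x assume "x \<in> fst c" "snd c x \<in> snd c ` (fst c \<inter> (N \<inter> G))"
        then have "x \<in> G" using chart_inj[OF ch] by (auto dest: inj_onD)
        then show "Q x" by (auto simp: G_def)
      qed auto
      then have "N \<subseteq> G" using N unfolding G_def N_def by blast
      then show False using y c(2) r(1) by (auto simp: N_def)
    qed
    then show ?thesis
      using N c(2) r(1) openin_subset[OF N] by (intro exI[of _ N]) (auto simp: N_def)
  qed
  then have "openin W (topspace W - G)" by (subst openin_subopen) blast
  then have "closedin W G" using openin_subset[OF G] by (simp add: closedin_def)
  moreover have "G \<noteq> {}" using M unfolding G_def by blast
  ultimately have "G = topspace W"
    using W G by (auto simp: riemann_surface_def connected_space_clopen_in)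
  then show ?thesis using y by (auto simp: G_def)
qed

lemma holomorphic_vanishes:
  assumes W: "riemann_surface W \<B>"
    and hol: "\<And>c. c \<in> \<B> \<Longrightarrow> (\<lambda>z. g (inv_into (fst c) (snd c) z)) holomorphic_on snd c ` fst c"
    and M: "openin W M" "M \<noteq> {}" "\<And>x. x \<in> M \<Longrightarrow> g x = (0::complex)"
    and y: "y \<in> topspace W"
  shows "g y = 0"
proof (rule surface_propagation[OF W _ M y])
  fix y assume "y \<in> topspace W"
  then obtain c where c: "c \<in> \<B>" "y \<in> fst c" using riemann_surface_chart_at[OF W] by blast
  note inv = chart_inverse[OF riemann_surface_chart[OF W c(1)]]
  let ?g = "\<lambda>z. g (inv_into (fst c) (snd c) z)"
  have "g x = 0" if hyp: "open D" "connected D" "D \<subseteq> snd c ` fst c" "open T" "T \<noteq> {}" "T \<subseteq> D"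
    "\<And>x. x \<in> fst c \<Longrightarrow> snd c x \<in> T \<Longrightarrow> g x = 0" "x \<in> fst c" "snd c x \<in> D" for D T x
  proof -
    have "?g (snd c x) = 0"
    proof (rule analytic_continuation_open[of T D ?g "\<lambda>_. 0"])
      show "?g holomorphic_on D" using hol[OF c(1)] hyp(3) holomorphic_on_subset by blast
      fix z assume "z \<in> T"
      then obtain x' where "z = snd c x'" "x' \<in> fst c" using hyp(3,6) by blast
      then show "?g z = 0" using hyp(7) \<open>z \<in> T\<close> by (simp add: inv)
    qed (use hyp in auto)
    then show ?thesis using hyp(8) by (simp add: inv)
  qed
  then show "\<exists>c\<in>\<B>. y \<in> fst c \<and>
      (\<forall>D T. open D \<and> connected D \<and> D \<subseteq> snd c ` fst c \<and> open T \<and> T \<noteq> {} \<and> T \<subseteq> D \<and>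
         (\<forall>x\<in>fst c. snd c x \<in> T \<longrightarrow> g x = 0) \<longrightarrow> (\<forall>x\<in>fst c. snd c x \<in> D \<longrightarrow> g x = 0))"
    using c by metis
qed

lemma holomorphic_section_chart:
  assumes "riemann_surface W \<B>" "holomorphic_section \<B> (topspace W) F" "c \<in> \<B>"
  shows "(\<lambda>z. nc_coeff (F (inv_into (fst c) (snd c) z)) w) holomorphic_on snd c ` fst c"
proof -
  have "fst c \<inter> topspace W = fst c"
    using chart_openin[OF riemann_surface_chart[OF assms(1,3)]] openin_subset by blast
  then show ?thesis
    using assms(2,3) unfolding holomorphic_section_def local_expr_def by metis
qed

text \<open>The difference \<open>f - g\<close> vanishes identically once its removable singularities are removed, so \<open>f\<close>
  has no poles; the convention on the values of \<open>f\<close> then gives equality at every point.\<close>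

lemma nicely_meromorphic_continuation:
  assumes f: "f nicely_meromorphic_on D" and D: "open D" "connected D"
    and g: "g holomorphic_on D" and T: "open T" "T \<noteq> {}" "T \<subseteq> D"
    and eq: "\<And>z. z \<in> T \<Longrightarrow> f z = g z" and z: "z \<in> D"
  shows "f z = g z"
proof -
  define h where "h = (\<lambda>z. f z - g z)"
  have "g analytic_on D" using g D(1) by (simp add: analytic_on_open)
  then have mero: "h meromorphic_on D"
    unfolding h_def using f analytic_on_imp_meromorphic_on
    by (intro meromorphic_intros) (auto simp: nicely_meromorphic_on_def)
  obtain z0 where z0: "z0 \<in> T" using T by blast
  have rem0: "remove_sings h w = 0" if "w \<in> T" for w
  proof -
    have "\<forall>\<^sub>F u in at w. h u = 0"
      using eventually_at_in_open'[OF T(1) that] by eventually_elim (simp add: h_def eq)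
    then have "h \<midarrow>w\<rightarrow> 0" by (rule tendsto_eventually)
    then show ?thesis by (rule remove_sings_eqI)
  qed
  have "\<forall>\<^sub>F u in at z0. remove_sings h u = 0"
    using eventually_at_in_open'[OF T(1) z0] by eventually_elim (rule rem0)
  then have "\<exists>\<^sub>F u in at z0. remove_sings h u = 0"
    by (intro eventually_frequently) auto
  from frequently_eq_meromorphic_imp_constant[OF this remove_sings_nicely_meromorphic[OF mero] D]
  have rem: "remove_sings h u = 0" if "u \<in> D" for u
    using z0 T(3) that by blast
  have "\<forall>\<^sub>F u in at z. remove_sings h u = h u"
    by (intro eventually_remove_sings_eq_at meromorphic_on_isolated_singularity
        meromorphic_on_subset[OF mero]) (use z in auto)
  with eventually_at_in_open'[OF D(1) z] have ev: "\<forall>\<^sub>F u in at z. g u = f u"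
    by eventually_elim (use rem in \<open>auto simp: h_def\<close>)
  have "g \<midarrow>z\<rightarrow> g z"
    using g D z by (meson continuous_on_eq_continuous_at continuous_at holomorphic_on_imp_continuous_on)
  then have lim: "f \<midarrow>z\<rightarrow> g z" by (rule Lim_transform_eventually[OF _ ev])
  then have "\<not> is_pole f z"
    using not_tendsto_and_filterlim_at_infinity[OF _ lim] by (auto simp: is_pole_def)
  then have "f \<midarrow>z\<rightarrow> f z" using f z by (auto simp: nicely_meromorphic_on_def)
  then show ?thesis using lim LIM_unique by blast
qed


section \<open>Horizontal sections on a surface spread over \<open>X\<close>\<close>

text \<open>Forms live on \<open>X\<close>, the continued sections on \<open>W\<close>. A chart \<open>d\<close> of \<open>X\<close> pulled back along \<open>p\<close> is a
  chart of \<open>W\<close> in whose coordinate \<open>p\<close> is the identity, so the pulled back form has the local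
  expression of \<open>\<omega>\<close> itself.\<close>

definition lifted_chart ::
    "'x chart set \<Rightarrow> 'y chart set \<Rightarrow> ('y \<Rightarrow> 'x) \<Rightarrow> 'x chart \<Rightarrow> 'y set \<Rightarrow> bool" where
  "lifted_chart \<A> \<B> p d N \<longleftrightarrow> d \<in> \<A> \<and> p ` N \<subseteq> fst d \<and> (N, snd d \<circ> p) \<in> \<B>"

definition horizontal_in_chart ::
    "('y \<Rightarrow> 'x) \<Rightarrow> ('v::finite \<Rightarrow> 'x form) \<Rightarrow> ('y \<Rightarrow> ('v, complex) ncps) \<Rightarrow>
     'x chart \<Rightarrow> 'y set \<Rightarrow> 'y \<Rightarrow> bool" where
  "horizontal_in_chart p \<omega> F d N y \<longleftrightarrow>
     nc_has_deriv (\<lambda>z. F (inv_into N (snd d \<circ> p) z))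
       (nc_form \<omega> d (snd d (p y)) * F y) (snd d (p y))"

definition horizontal_at ::
    "'x chart set \<Rightarrow> 'y chart set \<Rightarrow> ('y \<Rightarrow> 'x) \<Rightarrow> ('v::finite \<Rightarrow> 'x form) \<Rightarrow>
     ('y \<Rightarrow> ('v, complex) ncps) \<Rightarrow> 'y \<Rightarrow> bool" where
  "horizontal_at \<A> \<B> p \<omega> F y \<longleftrightarrow>
     (\<forall>d N. lifted_chart \<A> \<B> p d N \<and> y \<in> N \<longrightarrow> horizontal_in_chart p \<omega> F d N y)"

lemma nc_form_linear: "nc_form \<omega> c z = nc_linear (\<lambda>v. \<omega> v c z)"
  by (simp add: nc_form_def nc_linear_def)

lemma lifted_chart_exists:
  assumes "local_biholomorphism W \<B> \<A> p" "y \<in> topspace W"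
  obtains d N where "lifted_chart \<A> \<B> p d N" "y \<in> N"
proof -
  obtain N U \<phi> where "y \<in> N" "(U, \<phi>) \<in> \<A>" "p ` N \<subseteq> U" "(N, \<phi> \<circ> p) \<in> \<B>"
    using assms unfolding local_biholomorphism_def by metis
  then show thesis by (intro that[of "(U, \<phi>)" N]) (auto simp: lifted_chart_def)
qed

lemma lifted_chart_facts:
  assumes W: "riemann_surface W \<B>" and lift: "lifted_chart \<A> \<B> p d N"
  shows lifted_chart_complex: "complex_chart W (N, snd d \<circ> p)"
    and lifted_chart_openin: "openin W N"
    and lifted_chart_inj: "inj_on (snd d \<circ> p) N"
    and lifted_chart_inverse:
      "y \<in> N \<Longrightarrow> inv_into N (snd d \<circ> p) (snd d (p y)) = y"
    and lifted_chart_open_image: "openin W S \<Longrightarrow> open ((snd d \<circ> p) ` (N \<inter> S))"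
proof -
  show ch: "complex_chart W (N, snd d \<circ> p)"
    using lift riemann_surface_chart[OF W] by (simp add: lifted_chart_def)
  show "openin W N" using chart_openin[OF ch] by simp
  show "inj_on (snd d \<circ> p) N" using chart_inj[OF ch] by simp
  show "inv_into N (snd d \<circ> p) (snd d (p y)) = y" if "y \<in> N"
    using chart_inverse[OF ch, of y] that by simp
  show "open ((snd d \<circ> p) ` (N \<inter> S))" if "openin W S"
    using chart_open_image[OF ch that] by simp
qed

lemma lifted_section_holomorphic:
  assumes "riemann_surface W \<B>" "holomorphic_section \<B> (topspace W) F" "lifted_chart \<A> \<B> p d N"
  shows "(\<lambda>z. nc_coeff (F (inv_into N (snd d \<circ> p) z)) w) holomorphic_on (snd d \<circ> p) ` N"
  using holomorphic_section_chart[OF assms(1,2), of "(N, snd d \<circ> p)" w] assms(3)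
  by (simp add: lifted_chart_def)

lemma projection_vimage_openin:
  assumes X: "riemann_surface X \<A>" and W: "riemann_surface W \<B>"
    and p: "local_biholomorphism W \<B> \<A> p" and S: "openin X S"
  shows "openin W {y \<in> topspace W. p y \<in> S}"
proof (subst openin_subopen, intro ballI)
  fix y assume y: "y \<in> {y \<in> topspace W. p y \<in> S}"
  then obtain d N where dN: "lifted_chart \<A> \<B> p d N" "y \<in> N"
    using lifted_chart_exists[OF p] by blast
  have d: "complex_chart X d" and pN: "p ` N \<subseteq> fst d"
    using dN riemann_surface_chart[OF X] by (auto simp: lifted_chart_def)
  let ?T = "{y' \<in> N. snd d (p y') \<in> snd d ` (fst d \<inter> S)}"
  have "openin W ?T"
    using chart_openin_vimage[OF lifted_chart_complex[OF W dN(1)] chart_open_image[OF d S]] by simp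
  moreover have "y \<in> ?T" using y dN(2) pN by auto
  moreover have "?T \<subseteq> {y \<in> topspace W. p y \<in> S}"
    using pN openin_subset[OF lifted_chart_openin[OF W dN(1)]] inj_onD[OF chart_inj[OF d]]
    by fastforce
  ultimately show "\<exists>T. openin W T \<and> y \<in> T \<and> T \<subseteq> {y \<in> topspace W. p y \<in> S}" by blast
qed

text \<open>Near a point of the image, \<open>e\<close> is the local inverse of \<open>p\<close>: if \<open>y\<close> and \<open>e (p y)\<close> lie in the same
  lifted chart, then they coincide since \<open>p\<close> identifies them.\<close>

lemma embedded_image_openin:
  assumes X: "riemann_surface X \<A>" and W: "riemann_surface W \<B>"
    and p: "local_biholomorphism W \<B> \<A> p" and e: "embedded_over X W p S e"
    and S: "openin X S" and R: "openin X R" "R \<subseteq> S"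
  shows "openin W (e ` R)"
proof (subst openin_subopen, intro ballI)
  have top: "topspace (subtopology X S) = S"
    using S by (meson openin_subset topspace_subtopology_subset)
  have pe: "p (e x) = x" if "x \<in> S" for x
    using e that by (simp add: embedded_over_def)
  have "homeomorphic_map (subtopology X S) (subtopology W (e ` S)) e"
    using e top by (simp add: embedded_over_def embedding_map_def)
  then have "continuous_map (subtopology X S) W e"
    by (meson continuous_map_in_subtopology homeomorphic_imp_continuous_map)
  note cont = openin_continuous_map_preimage[OF this] continuous_map_image_subset_topspace[OF this]
  fix y assume "y \<in> e ` R"
  then obtain x where x: "x \<in> R" "y = e x" by blast
  have "y \<in> topspace W" using cont(2) x R(2) top by auto
  then obtain d N where dN: "lifted_chart \<A> \<B> p d N" "y \<in> N"
    using lifted_chart_exists[OF p] by blast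
  note N = lifted_chart_openin[OF W dN(1)]
  have "openin X {x \<in> S. e x \<in> N}"
    using cont(1)[OF N] S unfolding top by (simp add: openin_open_subtopology)
  then have R': "openin X ({x \<in> S. e x \<in> N} \<inter> R)" using R(1) by blast
  define T where "T = N \<inter> {y \<in> topspace W. p y \<in> {x \<in> S. e x \<in> N} \<inter> R}"
  have "openin W T"
    unfolding T_def by (intro openin_Int N projection_vimage_openin[OF X W p R'])
  moreover have "y \<in> T"
    using dN(2) x R(2) \<open>y \<in> topspace W\<close> by (auto simp: T_def pe)
  moreover have "T \<subseteq> e ` R"
  proof
    fix y' assume y': "y' \<in> T"
    then have "e (p y') = y'"
      by (intro inj_onD[OF lifted_chart_inj[OF W dN(1)]]) (auto simp: T_def pe)
    then show "y' \<in> e ` R" using y' by (force simp: T_def)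
  qed
  ultimately show "\<exists>T. openin W T \<and> y \<in> T \<and> T \<subseteq> e ` R" by blast
qed

text \<open>The chain rule and the transformation rule of forms contribute the same factor.\<close>

lemma horizontal_in_chart_change:
  assumes X: "riemann_surface X \<A>" and W: "riemann_surface W \<B>"
    and \<omega>: "\<And>v. meromorphic_form \<A> (\<omega> v)"
    and dN: "lifted_chart \<A> \<B> p d N" "y \<in> N"
    and hor: "horizontal_in_chart p \<omega> F d N y"
  shows "horizontal_at \<A> \<B> p \<omega> F y"
  unfolding horizontal_at_def
proof (intro allI impI, elim conjE)
  fix d' N' assume dN': "lifted_chart \<A> \<B> p d' N'" "y \<in> N'"
  have d: "d \<in> \<A>" "p ` N \<subseteq> fst d" and d': "d' \<in> \<A>" "p ` N' \<subseteq> fst d'"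
    using dN dN' by (auto simp: lifted_chart_def)
  note ch = riemann_surface_chart[OF X d(1)] and ch' = riemann_surface_chart[OF X d'(1)]
  define \<tau> where "\<tau> = transition d' d"
  define z where "z = snd d' (p y)"
  have \<tau>: "\<tau> (snd d' (p x)) = snd d (p x)" if "x \<in> N'" for x
    using chart_inverse[OF ch', of "p x"] d' that by (auto simp: \<tau>_def transition_def)
  have z: "z \<in> snd d' ` (fst d' \<inter> fst d)" using dN dN' d d' by (auto simp: z_def)
  have "\<tau> holomorphic_on snd d' ` (fst d' \<inter> fst d)"
    using X d d' unfolding riemann_surface_def compatible_def \<tau>_def by blast
  then have d\<tau>: "(\<tau> has_field_derivative deriv \<tau> z) (at z)"
    using chart_open_image[OF ch' chart_openin[OF ch]] z by (rule holomorphic_derivI)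
  have "nc_has_deriv (\<lambda>z. F (inv_into N (snd d \<circ> p) z)) (nc_form \<omega> d (\<tau> z) * F y) (\<tau> z)"
    using hor by (simp add: horizontal_in_chart_def z_def \<tau> dN'(2))
  from nc_has_deriv_compose[OF this d\<tau>]
  have "nc_has_deriv (\<lambda>z. F (inv_into N (snd d \<circ> p) (\<tau> z)))
      (nc_const (deriv \<tau> z) * (nc_form \<omega> d (\<tau> z) * F y)) z" .
  moreover have "nc_const (deriv \<tau> z) * (nc_form \<omega> d (\<tau> z) * F y) = nc_form \<omega> d' z * F y"
  proof -
    have "\<omega> v d' z = deriv \<tau> z * \<omega> v d (\<tau> z)" for v
      using \<omega>[of v] d(1) d'(1) z unfolding meromorphic_form_def \<tau>_def
      by (metis mult.commute)
    then show ?thesis by (simp add: nc_form_linear nc_const_mult_linear flip: mult.assoc)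
  qed
  ultimately have "nc_has_deriv (\<lambda>z. F (inv_into N (snd d \<circ> p) (\<tau> z))) (nc_form \<omega> d' z * F y) z"
    by simp
  then have "nc_has_deriv (\<lambda>z. F (inv_into N' (snd d' \<circ> p) z)) (nc_form \<omega> d' z * F y) z"
  proof (rule nc_has_deriv_transform)
    show "open ((snd d' \<circ> p) ` (N' \<inter> N))"
      by (rule lifted_chart_open_image[OF W dN'(1) lifted_chart_openin[OF W dN(1)]])
    show "z \<in> (snd d' \<circ> p) ` (N' \<inter> N)" using dN(2) dN'(2) by (auto simp: z_def)
    fix u assume "u \<in> (snd d' \<circ> p) ` (N' \<inter> N)"
    then show "F (inv_into N (snd d \<circ> p) (\<tau> u)) = F (inv_into N' (snd d' \<circ> p) u)"
      by (auto simp: \<tau> lifted_chart_inverse[OF W dN(1)] lifted_chart_inverse[OF W dN'(1)])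
  qed
  then show "horizontal_in_chart p \<omega> F d' N' y"
    by (simp add: horizontal_in_chart_def z_def)
qed

text \<open>In a chart let \<open>f\<^sub>w\<close> be the coefficients of \<open>F\<close>. As \<open>f\<close> of the empty word is \<open>1\<close>, horizontality
  on an open set contains the equations \<open>f\<^sub>v' = \<omega>\<^sub>v\<close> for the letters \<open>v\<close>. They first spread by the
  identity theorem for meromorphic functions and show that \<open>\<omega>\<^sub>v\<close> is holomorphic; after that the
  equations for the longer words are identities between holomorphic functions.\<close>

lemma horizontal_propagates:
  assumes X: "riemann_surface X \<A>" and W: "riemann_surface W \<B>"
    and p: "local_biholomorphism W \<B> \<A> p"
    and \<omega>: "\<And>v. meromorphic_form \<A> (\<omega> v)"
    and F: "holomorphic_section \<B> (topspace W) F" "\<And>y. y \<in> topspace W \<Longrightarrow> nc_coeff (F y) [] = 1"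
    and M: "openin W M" "M \<noteq> {}" "\<And>y. y \<in> M \<Longrightarrow> horizontal_at \<A> \<B> p \<omega> F y"
    and y: "y \<in> topspace W"
  shows "horizontal_at \<A> \<B> p \<omega> F y"
proof (rule surface_propagation[OF W _ M y])
  fix y assume "y \<in> topspace W"
  then obtain d N where dN: "lifted_chart \<A> \<B> p d N" "y \<in> N"
    using lifted_chart_exists[OF p] by blast
  let ?\<phi> = "snd d \<circ> p"
  note inv = lifted_chart_inverse[OF W dN(1)]
  have d: "d \<in> \<A>" "p ` N \<subseteq> fst d" and B: "(N, ?\<phi>) \<in> \<B>"
    using dN by (auto simp: lifted_chart_def)
  define f where "f = (\<lambda>w z. nc_coeff (F (inv_into N ?\<phi> z)) w)"
  define g where "g = (\<lambda>w z. case w of [] \<Rightarrow> 0 | v # u \<Rightarrow> \<omega> v d z * f u z)"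
  have hor_iff: "horizontal_in_chart p \<omega> F d N x \<longleftrightarrow>
      (\<forall>w. (f w has_field_derivative g w (?\<phi> x)) (at (?\<phi> x)))" if "x \<in> N" for x
    using that unfolding horizontal_in_chart_def nc_has_deriv_def nc_form_linear
    by (auto simp: f_def g_def nc_coeff_linear_mult inv split: list.splits)
  have extend: "horizontal_at \<A> \<B> p \<omega> F x"
    if D: "open D" "connected D" "D \<subseteq> ?\<phi> ` N" and T: "open T" "T \<noteq> {}" "T \<subseteq> D"
      and hor: "\<forall>x\<in>N. ?\<phi> x \<in> T \<longrightarrow> horizontal_at \<A> \<B> p \<omega> F x"
      and x: "x \<in> N" "?\<phi> x \<in> D" for D T x
  proof -
    have fhol: "f w holomorphic_on D" for w
      unfolding f_def
      using lifted_section_holomorphic[OF W F(1) dN(1)] D(3) by (rule holomorphic_on_subset)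
    then have f'hol: "deriv (f w) holomorphic_on D" for w
      using D(1) by (rule holomorphic_deriv)
    have f0: "f [] z = 1" if z: "z \<in> D" for z
    proof -
      obtain x' where "x' \<in> N" "z = ?\<phi> x'" using z D(3) by blast
      then show ?thesis
        using F(2) openin_subset[OF lifted_chart_openin[OF W dN(1)]] by (auto simp: f_def inv)
    qed
    have eqT: "deriv (f w) z = g w z" if z: "z \<in> T" for w z
    proof -
      obtain x' where x': "x' \<in> N" "z = ?\<phi> x'" using z T D by blast
      then have "horizontal_in_chart p \<omega> F d N x'"
        using hor z dN(1) unfolding horizontal_at_def by blast
      then show ?thesis using x' by (auto simp: hor_iff intro: DERIV_imp_deriv)
    qed
    have \<omega>D: "\<omega> v d nicely_meromorphic_on D" for v
    proof (rule nicely_meromorphic_on_subset)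
      show "\<omega> v d nicely_meromorphic_on snd d ` fst d"
        using \<omega>[of v] d(1) by (simp add: meromorphic_form_def)
      show "D \<subseteq> snd d ` fst d" using D(3) d(2) by fastforce
    qed
    have "\<omega> v d z = deriv (f [v]) z" if "z \<in> D" for v z
      by (rule nicely_meromorphic_continuation[OF \<omega>D D(1,2) f'hol T _ that])
         (use eqT[of _ "[v]"] f0 T in \<open>auto simp: g_def\<close>)
    then have \<omega>hol: "\<omega> v d holomorphic_on D" for v
      using f'hol[of "[v]"] by (metis holomorphic_transform)
    have ghol: "g w holomorphic_on D" for w
      by (cases w) (auto simp: g_def intro!: holomorphic_intros \<omega>hol fhol)
    have "deriv (f w) z = g w z" if "z \<in> D" for w z
      by (rule analytic_continuation_open[OF T(1) D(1) T(2) D(2) T(3) f'hol ghol eqT that])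
    then have "horizontal_in_chart p \<omega> F d N x"
      unfolding hor_iff[OF x(1)] using holomorphic_derivI[OF fhol D(1) x(2)] x(2) by metis
    then show ?thesis by (rule horizontal_in_chart_change[OF X W \<omega> dN(1) x(1)])
  qed
  show "\<exists>c\<in>\<B>. y \<in> fst c \<and>
      (\<forall>D T. open D \<and> connected D \<and> D \<subseteq> snd c ` fst c \<and> open T \<and> T \<noteq> {} \<and> T \<subseteq> D \<and>
         (\<forall>x\<in>fst c. snd c x \<in> T \<longrightarrow> horizontal_at \<A> \<B> p \<omega> F x) \<longrightarrow>
         (\<forall>x\<in>fst c. snd c x \<in> D \<longrightarrow> horizontal_at \<A> \<B> p \<omega> F x))"
    using dN(2) extend by (intro bexI[OF _ B]) (unfold fst_conv snd_conv, blast)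
qed


section \<open>Normalized sections and the scattering operator\<close>

text \<open>\<open>K\<close> is known to extend only to a neighbourhood of \<open>a\<close>, so the comparison with the value at
  \<open>a\<close> is made where \<open>t\<close> lies in a small disc; the identity theorem will carry the result further. The
  part of the slit disc over it is nonempty as the cut avoids the positive real axis.\<close>

lemma normalized_section_grouplike:
  assumes X: "riemann_surface X \<A>"
    and disc: "regular_disc \<A> \<omega> a U t r" and slit: "slit_disc U t r U'"
    and J: "normalized_section X \<A> \<omega> a U t U' J"
  shows "openin X U'"
    and "\<exists>S. openin X S \<and> S \<noteq> {} \<and> S \<subseteq> U' \<and>
      (\<forall>x\<in>S. nc_grouplike (J x) \<and> nc_coeff (J x) [] = 1)"
proof -
  have c: "(U, t) \<in> \<A>" and a: "a \<in> U" "t a = 0" and r: "0 < r" "t ` U = ball 0 r"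
    using disc by (auto simp: regular_disc_def)
  note ch = riemann_surface_chart[OF X c]
  have inv: "inv_into U t (t x) = x" if "x \<in> U" for x
    using chart_inverse[OF ch, of x] that by simp
  obtain \<gamma> where \<gamma>: "arc \<gamma>"
    "\<And>z. z \<in> path_image \<gamma> \<Longrightarrow> z \<in> ball 0 r \<Longrightarrow> \<not> (Im z = 0 \<and> Re z > 0)"
    "U' = {x \<in> U. t x \<notin> path_image \<gamma>}"
    using slit unfolding slit_disc_def by blast
  have cut: "open (- path_image \<gamma>)"
    using \<gamma>(1) by (simp add: closed_arc_image open_Compl)
  show U': "openin X U'"
    using chart_openin_vimage[OF ch cut] \<gamma>(3) by simp
  have U'U: "U \<inter> U' = U'" using \<gamma>(3) by auto
  have tU': "open (t ` U')" using chart_open_image[OF ch U'] U'U by simp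
  obtain l K N where l: "log_branch (t ` U') l" and N: "openin X N" "a \<in> N"
    and K: "holomorphic_section \<A> N K" "K a = 1"
    and JK: "\<And>x. x \<in> U' \<Longrightarrow> J x = K x * nc_exp (nc_residue \<omega> (U, t) a * nc_const (l (t x)))"
    and hor: "horizontal_section \<A> \<omega> U' J"
    using J unfolding normalized_section_def by metis
  obtain \<epsilon> where \<epsilon>: "\<epsilon> > 0" "ball 0 \<epsilon> \<subseteq> t ` (U \<inter> N)"
    using chart_ball[OF ch _ N] a by auto
  define D where "D = ball (0::complex) \<epsilon>"
  define T where "T = D \<inter> t ` U'"
  let ?\<tau> = "inv_into U t"
  have T: "open T" "T \<subseteq> D" using tU' by (auto simp: T_def D_def)
  have "T \<noteq> {}"
  proof -
    \<comment> \<open>A point of the positive real axis in the small disc.\<close>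
    have mem: "of_real (\<epsilon> / 2) \<in> D" using \<epsilon>(1) by (simp add: D_def)
    then have "of_real (\<epsilon> / 2) \<in> t ` U" using \<epsilon>(2) unfolding D_def by blast
    then obtain x where x: "x \<in> U" "t x = of_real (\<epsilon> / 2)" by (metis imageE)
    have "Im (t x) = 0" "Re (t x) > 0" unfolding x(2) using \<epsilon>(1) by simp_all
    then have "t x \<notin> path_image \<gamma>" using \<gamma>(2)[of "t x"] x(1) r(2) by blast
    then have "x \<in> U'" using x(1) \<gamma>(3) by blast
    moreover have "t x \<in> D" unfolding x(2) by (rule mem)
    ultimately show ?thesis unfolding T_def by blast
  qed
  have R: "nc_residue \<omega> (U, t) a = nc_linear (\<lambda>v. form_residue (\<omega> v) (U, t) a)"
    by (simp add: nc_residue_def nc_linear_def)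
  have TU': "z \<in> T \<Longrightarrow> \<exists>x\<in>U'. z = t x" for z by (auto simp: T_def)
  have Khol: "(\<lambda>z. nc_coeff (K (?\<tau> z)) w) holomorphic_on D" for w
  proof -
    have "local_expr K (U, t) w holomorphic_on snd (U, t) ` (fst (U, t) \<inter> N)"
      using K(1) c unfolding holomorphic_section_def by blast
    then show ?thesis
      using \<epsilon>(2) unfolding local_expr_def D_def fst_conv snd_conv by (rule holomorphic_on_subset)
  qed
  have K0: "K (?\<tau> 0) = 1" using inv[OF a(1)] a K by simp
  have lT: "l holomorphic_on T"
    using l unfolding log_branch_def T_def by (meson holomorphic_on_subset inf_le2)
  have JT: "J (?\<tau> z) = K (?\<tau> z) *
      nc_exp (nc_linear (\<lambda>v. form_residue (\<omega> v) (U, t) a) * nc_const (l z))" if "z \<in> T" for z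
    using TU'[OF that] JK \<gamma>(3) by (auto simp: inv R)
  have dJ: "nc_has_deriv (\<lambda>z. J (?\<tau> z)) (nc_linear (\<lambda>v. \<omega> v (U, t) z) * J (?\<tau> z)) z"
    if z: "z \<in> T" for z
    unfolding nc_has_deriv_def
  proof
    fix w
    obtain x where x: "x \<in> U'" "z = t x" using TU'[OF z] by blast
    have "local_expr J (U, t) w holomorphic_on snd (U, t) ` (fst (U, t) \<inter> U')"
      using hor c unfolding horizontal_section_def holomorphic_section_def by blast
    then have "local_expr J (U, t) w holomorphic_on t ` U'" by (simp add: U'U)
    from holomorphic_derivI[OF this tU', of z]
    have jd: "(local_expr J (U, t) w has_field_derivative deriv (local_expr J (U, t) w) z) (at z)"
      using x by simp
    have "x \<in> fst (U, t) \<inter> U'" using x(1) by (simp add: U'U)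
    with hor c have "deriv (local_expr J (U, t) w) (snd (U, t) x) =
        nc_coeff (nc_form \<omega> (U, t) (snd (U, t) x) * J x) w"
      unfolding horizontal_section_def by blast
    with jd show "((\<lambda>z. nc_coeff (J (?\<tau> z)) w) has_field_derivative
        nc_coeff (nc_linear (\<lambda>v. \<omega> v (U, t) z) * J (?\<tau> z)) w) (at z)"
      using x \<gamma>(3) by (simp add: local_expr_def[abs_def] inv nc_form_linear)
  qed
  have D: "open D" "connected D" "0 \<in> D" using \<epsilon>(1) by (auto simp: D_def)
  note grouplike = nc_grouplike_normalized[where J = "\<lambda>z. J (?\<tau> z)" and K = "\<lambda>z. K (?\<tau> z)",
      OF D T(1) \<open>T \<noteq> {}\<close> T(2) Khol K0 lT JT dJ]
  define S where "S = {x \<in> U. t x \<in> T}"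
  have SU': "S \<subseteq> U'"
  proof
    fix x assume "x \<in> S"
    then have x: "x \<in> U" "t x \<in> T" by (simp_all add: S_def)
    then obtain x' where "t x = t x'" "x' \<in> U'" using TU' by blast
    then show "x \<in> U'" using x(1) \<gamma>(3) by simp
  qed
  have "openin X S" using chart_openin_vimage[OF ch T(1)] by (simp add: S_def)
  moreover have "S \<noteq> {}"
  proof -
    obtain z x where "z \<in> T" "x \<in> U'" "z = t x" using \<open>T \<noteq> {}\<close> TU' by blast
    then have "x \<in> S" using \<gamma>(3) by (simp add: S_def)
    then show ?thesis by blast
  qed
  moreover have "nc_grouplike (J x) \<and> nc_coeff (J x) [] = 1" if "x \<in> S" for x
  proof -
    have "x \<in> U" "t x \<in> T" using that by (simp_all add: S_def)
    then show ?thesis using grouplike[of "t x"] by (simp add: inv)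
  qed
  ultimately show "\<exists>S. openin X S \<and> S \<noteq> {} \<and> S \<subseteq> U' \<and>
      (\<forall>x\<in>S. nc_grouplike (J x) \<and> nc_coeff (J x) [] = 1)"
    using SU' by blast
qed

text \<open>In a lifted chart of \<open>W\<close> around \<open>e x\<close> the section \<open>F\<close> has the same local expression as \<open>J\<close> in the
  underlying chart of \<open>X\<close>.\<close>

lemma embedded_horizontal:
  assumes X: "riemann_surface X \<A>" and W: "riemann_surface W \<B>"
    and p: "local_biholomorphism W \<B> \<A> p" and e: "embedded_over X W p S e"
    and S: "openin X S" and R: "openin X R" "R \<subseteq> S"
    and J: "horizontal_section \<A> \<omega> S J" and F: "\<And>x. x \<in> S \<Longrightarrow> F (e x) = J x"
    and y: "y \<in> e ` R"
  shows "horizontal_at \<A> \<B> p \<omega> F y"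
  unfolding horizontal_at_def
proof (intro allI impI, elim conjE)
  fix d N assume dN: "lifted_chart \<A> \<B> p d N" "y \<in> N"
  have d: "d \<in> \<A>" "p ` N \<subseteq> fst d" using dN by (auto simp: lifted_chart_def)
  note ch = riemann_surface_chart[OF X d(1)]
  have pe: "p (e x) = x" if "x \<in> S" for x
    using e that by (simp add: embedded_over_def)
  obtain x where x: "x \<in> R" "y = e x" using y by blast
  have xS: "x \<in> fst d \<inter> S" using x dN(2) d R pe by fastforce
  have px: "p y = x" using x R pe by auto
  have "nc_has_deriv (\<lambda>z. J (inv_into (fst d) (snd d) z)) (nc_form \<omega> d (snd d x) * J x) (snd d x)"
    unfolding nc_has_deriv_def
  proof
    fix w
    have "local_expr J d w holomorphic_on snd d ` (fst d \<inter> S)"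
      using J d(1) unfolding horizontal_section_def holomorphic_section_def by blast
    from holomorphic_derivI[OF this chart_open_image[OF ch S], of "snd d x"]
    have "(local_expr J d w has_field_derivative deriv (local_expr J d w) (snd d x)) (at (snd d x))"
      using xS by blast
    moreover have "deriv (local_expr J d w) (snd d x) = nc_coeff (nc_form \<omega> d (snd d x) * J x) w"
      using J d(1) xS unfolding horizontal_section_def by blast
    ultimately show "((\<lambda>z. nc_coeff (J (inv_into (fst d) (snd d) z)) w) has_field_derivative
        nc_coeff (nc_form \<omega> d (snd d x) * J x) w) (at (snd d x))"
      by (simp add: local_expr_def[abs_def])
  qed
  then have "nc_has_deriv (\<lambda>z. F (inv_into N (snd d \<circ> p) z))
      (nc_form \<omega> d (snd d x) * J x) (snd d x)"
  proof (rule nc_has_deriv_transform)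
    show "open ((snd d \<circ> p) ` (N \<inter> e ` R))"
      by (rule lifted_chart_open_image[OF W dN(1) embedded_image_openin[OF X W p e S R]])
    show "snd d x \<in> (snd d \<circ> p) ` (N \<inter> e ` R)" using dN(2) y px by force
    fix z assume "z \<in> (snd d \<circ> p) ` (N \<inter> e ` R)"
    then obtain u where u: "u \<in> R" "e u \<in> N" "z = snd d (p (e u))" by auto
    then have "u \<in> fst d" using d R pe by fastforce
    then have "inv_into (fst d) (snd d) z = u" using u R pe chart_inverse[OF ch] by auto
    moreover have "inv_into N (snd d \<circ> p) z = e u"
      unfolding u(3) by (rule lifted_chart_inverse[OF W dN(1) u(2)])
    ultimately show "J (inv_into (fst d) (snd d) z) = F (inv_into N (snd d \<circ> p) z)"
      using F u R by auto
  qed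
  then show "horizontal_in_chart p \<omega> F d N y"
    using F[of x] xS unfolding horizontal_in_chart_def px by (simp add: x(2))
qed

lemma continuation_properties:
  assumes X: "riemann_surface X \<A>" and W: "riemann_surface W \<B>"
    and p: "local_biholomorphism W \<B> \<A> p"
    and \<omega>: "\<And>v. meromorphic_form \<A> (\<omega> v)"
    and disc: "regular_disc \<A> \<omega> a U t r" and slit: "slit_disc U t r U'"
    and J: "normalized_section X \<A> \<omega> a U t U' J"
    and e: "embedded_over X W p U' e"
    and F: "analytic_continuation W \<B> U' e J F"
    and y: "y \<in> topspace W"
  shows "nc_coeff (F y) [] = 1" and "nc_grouplike (F y)" and "horizontal_at \<A> \<B> p \<omega> F y"
proof -
  note U' = normalized_section_grouplike(1)[OF X disc slit J]
  obtain S where S: "openin X S" "S \<noteq> {}" "S \<subseteq> U'"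
    "\<And>x. x \<in> S \<Longrightarrow> nc_grouplike (J x) \<and> nc_coeff (J x) [] = 1"
    using normalized_section_grouplike(2)[OF X disc slit J] by blast
  have hol: "holomorphic_section \<B> (topspace W) F" and FJ: "\<And>x. x \<in> U' \<Longrightarrow> F (e x) = J x"
    using F by (auto simp: analytic_continuation_def)
  note M = embedded_image_openin[OF X W p e U' S(1,3)]
  have M0: "e ` S \<noteq> {}" using S by simp
  note chol = holomorphic_section_chart[OF W hol]
  have one: "nc_coeff (F y) [] = 1" if "y \<in> topspace W" for y
  proof -
    have "nc_coeff (F y) [] - 1 = 0"
      by (rule holomorphic_vanishes[OF W _ M M0 _ that])
         (use S FJ in \<open>auto intro!: holomorphic_intros chol\<close>)
    then show ?thesis by simp
  qed
  then show "nc_coeff (F y) [] = 1" using y by blast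
  show "nc_grouplike (F y)"
    unfolding nc_grouplike_def
  proof (intro ncps_eqI)
    fix u w
    have "coeff2 (coproduct (F y)) u w - coeff2 (F y \<otimes>\<^sub>A F y) u w = 0"
    proof (rule holomorphic_vanishes[OF W _ M M0 _ y])
      fix c assume "c \<in> \<B>"
      then show "(\<lambda>z. coeff2 (coproduct (F (inv_into (fst c) (snd c) z))) u w -
          coeff2 (F (inv_into (fst c) (snd c) z) \<otimes>\<^sub>A F (inv_into (fst c) (snd c) z)) u w)
          holomorphic_on snd c ` fst c"
        unfolding coproduct_eq_series coeff2_coproduct_series coeff2_tensor
        by (intro holomorphic_intros chol)
    next
      fix x assume "x \<in> e ` S"
      then have "nc_grouplike (F x)" using S FJ by auto
      then show "coeff2 (coproduct (F x)) u w - coeff2 (F x \<otimes>\<^sub>A F x) u w = 0"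
        by (simp add: nc_grouplike_def)
    qed
    then show "coeff2 (coproduct (F y)) u w = coeff2 (F y \<otimes>\<^sub>A F y) u w" by simp
  qed
  have hor: "horizontal_section \<A> \<omega> U' J" using J by (simp add: normalized_section_def)
  show "horizontal_at \<A> \<B> p \<omega> F y"
    by (rule horizontal_propagates[OF X W p \<omega> hol _ M M0 _ y])
       (blast intro: one embedded_horizontal[OF X W p e U' S(1,3) hor FJ])+
qed

text \<open>The difference \<open>E = F - G C\<close> is horizontal and vanishes at \<open>y0\<close>. If its coefficients at shorter
  words vanish on \<open>W\<close>, then the coefficient at \<open>w\<close> has derivative zero near \<open>y0\<close>, so it vanishes near
  \<open>y0\<close> and by the identity theorem everywhere.\<close>

lemma horizontal_right_multiple:
  assumes W: "riemann_surface W \<B>" and p: "local_biholomorphism W \<B> \<A> p"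
    and F: "holomorphic_section \<B> (topspace W) F"
      "\<And>y. y \<in> topspace W \<Longrightarrow> horizontal_at \<A> \<B> p \<omega> F y"
    and G: "holomorphic_section \<B> (topspace W) G"
      "\<And>y. y \<in> topspace W \<Longrightarrow> horizontal_at \<A> \<B> p \<omega> G y"
    and y0: "y0 \<in> topspace W" and init: "F y0 = G y0 * C" and y: "y \<in> topspace W"
  shows "F y = G y * C"
proof -
  define E where "E = (\<lambda>y. F y - G y * C)"
  have Ehol: "(\<lambda>z. nc_coeff (E (inv_into (fst c) (snd c) z)) w) holomorphic_on snd c ` fst c"
    if "c \<in> \<B>" for c w
    unfolding E_def nc_coeff_diff nc_coeff_mult
    by (intro holomorphic_intros holomorphic_section_chart[OF W] F G that)
  obtain d N where dN: "lifted_chart \<A> \<B> p d N" "y0 \<in> N"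
    using lifted_chart_exists[OF p y0] by blast
  let ?\<phi> = "snd d \<circ> p"
  note inv = lifted_chart_inverse[OF W dN(1)]
  have NW: "N \<subseteq> topspace W" using openin_subset[OF lifted_chart_openin[OF W dN(1)]] .
  have dE: "nc_has_deriv (\<lambda>z. E (inv_into N ?\<phi> z)) (nc_form \<omega> d (?\<phi> x) * E x) (?\<phi> x)"
    if "x \<in> N" for x
  proof -
    have "nc_has_deriv (\<lambda>z. F (inv_into N ?\<phi> z)) (nc_form \<omega> d (?\<phi> x) * F x) (?\<phi> x)"
      "nc_has_deriv (\<lambda>z. G (inv_into N ?\<phi> z)) (nc_form \<omega> d (?\<phi> x) * G x) (?\<phi> x)"
      using F(2)[of x] G(2)[of x] that NW dN(1)
      unfolding horizontal_at_def horizontal_in_chart_def o_apply by blast+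
    moreover have "nc_has_deriv (\<lambda>z. C) 0 (?\<phi> x)"
      by (simp add: nc_has_deriv_def nc_coeff_0)
    ultimately have "nc_has_deriv (\<lambda>z. F (inv_into N ?\<phi> z) - G (inv_into N ?\<phi> z) * C)
       (nc_form \<omega> d (?\<phi> x) * F x -
          (nc_form \<omega> d (?\<phi> x) * G x * C + G (inv_into N ?\<phi> (?\<phi> x)) * 0)) (?\<phi> x)"
      by (intro nc_has_deriv_diff nc_has_deriv_mult)
    then show ?thesis by (simp add: E_def algebra_simps)
  qed
  obtain r where r: "r > 0" "ball (?\<phi> y0) r \<subseteq> ?\<phi> ` N"
    using chart_ball[OF lifted_chart_complex[OF W dN(1)], of y0 "topspace W"] dN(2) y0 NW
    by (auto simp: Int_absorb2)
  have "nc_coeff (E y) w = 0" if "y \<in> topspace W" for w y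
    using that
  proof (induction "length w" arbitrary: w y rule: less_induct)
    case less
    define M where "M = {x \<in> N. ?\<phi> x \<in> ball (?\<phi> y0) r}"
    show ?case
    proof (rule holomorphic_vanishes[OF W Ehol _ _ _ less.prems])
      show "openin W M"
        using chart_openin_vimage[OF lifted_chart_complex[OF W dN(1)], of "ball (?\<phi> y0) r"]
        by (simp add: M_def)
      show "M \<noteq> {}" using dN(2) r(1) by (auto simp: M_def)
      fix x assume x: "x \<in> M"
      have "nc_coeff (E (inv_into N ?\<phi> (?\<phi> x))) w = nc_coeff (E (inv_into N ?\<phi> (?\<phi> y0))) w"
      proof (rule holomorphic_deriv_zero_constant[where D = "ball (?\<phi> y0) r"
            and T = "ball (?\<phi> y0) r" and f = "\<lambda>z. nc_coeff (E (inv_into N ?\<phi> z)) w"])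
        show "(\<lambda>z. nc_coeff (E (inv_into N ?\<phi> z)) w) holomorphic_on ball (?\<phi> y0) r"
          using Ehol[of "(N, ?\<phi>)" w] dN(1) r(2)
          by (auto simp: lifted_chart_def intro: holomorphic_on_subset)
        fix z assume "z \<in> ball (?\<phi> y0) r"
        then obtain x' where x': "x' \<in> N" "z = ?\<phi> x'" using r by blast
        have "nc_coeff (nc_form \<omega> d z * E x') w = 0"
          using less.hyps[of _ x'] x'(1) NW
          by (cases w) (auto simp: nc_form_linear nc_coeff_linear_mult)
        then show "((\<lambda>z. nc_coeff (E (inv_into N ?\<phi> z)) w) has_field_derivative 0) (at z)"
          using dE[OF x'(1)] unfolding nc_has_deriv_def x'(2) by metis
      qed (use x r(1) in \<open>auto simp: M_def\<close>)
      then show "nc_coeff (E x) w = 0"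
        using x dN(2) init by (simp add: M_def inv E_def nc_coeff_0)
    qed
  qed
  then have "E y = 0" using y by (intro ncps_eqI) (simp add: nc_coeff_0)
  then show ?thesis by (simp add: E_def)
qed

theorem mainTheorem12:
  fixes X :: "'x topology" and \<A> :: "'x chart set"
    and W :: "'y topology" and \<B> :: "'y chart set" and p :: "'y \<Rightarrow> 'x"
    and \<omega> :: "'v::finite \<Rightarrow> 'x form"
    and a b :: 'x and U\<^sub>a U\<^sub>b U\<^sub>a' U\<^sub>b' :: "'x set" and t\<^sub>a t\<^sub>b :: "'x \<Rightarrow> complex"
    and r\<^sub>a r\<^sub>b :: real
    and J\<^sub>a J\<^sub>b :: "'x \<Rightarrow> ('v, complex) ncps" and e\<^sub>a e\<^sub>b :: "'x \<Rightarrow> 'y"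
    and F\<^sub>a F\<^sub>b :: "'y \<Rightarrow> ('v, complex) ncps"
  assumes "riemann_surface X \<A>" and "a \<in> topspace X" and "b \<in> topspace X"
    and "\<And>v. meromorphic_form \<A> (\<omega> v)"
    and "\<And>v. at_most_log_singularity \<A> (\<omega> v) a"
    and "\<And>v. at_most_log_singularity \<A> (\<omega> v) b"
    and "regular_disc \<A> \<omega> a U\<^sub>a t\<^sub>a r\<^sub>a" and "slit_disc U\<^sub>a t\<^sub>a r\<^sub>a U\<^sub>a'"
    and "regular_disc \<A> \<omega> b U\<^sub>b t\<^sub>b r\<^sub>b" and "slit_disc U\<^sub>b t\<^sub>b r\<^sub>b U\<^sub>b'"
    and "normalized_section X \<A> \<omega> a U\<^sub>a t\<^sub>a U\<^sub>a' J\<^sub>a"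
    and "normalized_section X \<A> \<omega> b U\<^sub>b t\<^sub>b U\<^sub>b' J\<^sub>b"
    and "riemann_surface W \<B>" and "simply_connected_space W"
    and "local_biholomorphism W \<B> \<A> p"
    and "embedded_over X W p U\<^sub>a' e\<^sub>a" and "embedded_over X W p U\<^sub>b' e\<^sub>b"
    and "analytic_continuation W \<B> U\<^sub>a' e\<^sub>a J\<^sub>a F\<^sub>a"
    and "analytic_continuation W \<B> U\<^sub>b' e\<^sub>b J\<^sub>b F\<^sub>b"
  shows "coproduct (scattering_operator W F\<^sub>a F\<^sub>b) =
           scattering_operator W F\<^sub>a F\<^sub>b \<otimes>\<^sub>A scattering_operator W F\<^sub>a F\<^sub>b"
proof -
  note X = assms(1) and W = assms(13) and p = assms(15) and \<omega> = assms(4)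
  note Fa = continuation_properties[OF X W p \<omega> assms(7,8,11,16,18)]
  note Fb = continuation_properties[OF X W p \<omega> assms(9,10,12,17,19)]
  have hol: "holomorphic_section \<B> (topspace W) F\<^sub>a" "holomorphic_section \<B> (topspace W) F\<^sub>b"
    using assms(18,19) by (auto simp: analytic_continuation_def)
  obtain y0 where y0: "y0 \<in> topspace W" using W unfolding riemann_surface_def by blast
  define C where "C = nc_inverse (F\<^sub>b y0) * F\<^sub>a y0"
  have init: "F\<^sub>a y0 = F\<^sub>b y0 * C"
    by (simp add: C_def nc_inverse_right[OF Fb(1)[OF y0]] flip: mult.assoc)
  have const: "nc_inverse (F\<^sub>b y) * F\<^sub>a y = C" if y: "y \<in> topspace W" for y
    using horizontal_right_multiple[OF W p hol(1) Fa(3) hol(2) Fb(3) y0 init y]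
    by (simp add: nc_inverse_left[OF Fb(1)[OF y]] flip: mult.assoc)
  then have "scattering_operator W F\<^sub>a F\<^sub>b = C"
    unfolding scattering_operator_def using y0 by (intro the_equality) auto
  moreover have "nc_grouplike C"
    unfolding C_def
    by (intro nc_grouplike_mult nc_grouplike_inverse Fa(2) Fb(1,2) y0)
  ultimately show ?thesis by (simp add: nc_grouplike_def)
qed

end
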